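(* Let $\mathcal{B}$ be a basis of a Banach space $X$. The following are equivalent (where, in each item containing "for all (some)", the version with "for all" and the version with "for some" are both included in the list of equivalent statements): (i) $\mathcal{B}$ is almost greedy. (ii) $\mathcal{B}$ is quasi-greedy and democratic. (iii) $\mathcal{B}$ is $\lambda$-greedy for all (some) $\lambda>1$. (iv) $\mathcal{B}$ is quasi-greedy and SLC. (v) $\mathcal{B}$ is quasi-greedy and is $\lambda$-democratic for all (some) $\lambda\geqslant 1$. (vi) $\mathcal{B}$ is quasi-greedy and $\lambda$-SLC for all (some) $\lambda\geqslant 1$. (vii) $\mathcal{B}$ is $\lambda$-almost greedy for all (some) $\lambda\geqslant 1$.
   Context: Let $(X,\|\cdot\|)$ be an infinite-dimensional Banach space over $\mathbb{K}=\mathbb{R}$ or $\mathbb{C}$ with dual $(X^*,\|\cdot\|_* )$. A basis of $X$ is a sequence $\mathcal{B}=(e_n)_{n=1}^\infty$ in $X$ such that: (1) there is a unique sequence $(e_n^* )_{n=1}^\infty$ in $X^*$ with $e_i^*(e_j)=\delta_{i,j}$ for all $i,j$; (2) $\sup_n\|e_n\|\|e_n^*\|_*<\infty$ and $0<\inf_n\|e_n\|\leqslant\sup_n\|e_n\|<\infty$; (3) $X$ is the norm-closed linear span of $\{e_n\}$; (4) $X^*$ is the weak$^*$-closed linear span of $\{e_n^*\}$. Notation: $\mathbb{N}_0=\mathbb{N}\cup\{0\}$; $\mathbb{N}^{<\infty}$ is the set of finite subsets of $\mathbb{N}$. $\mathrm{supp}(x)=\{n:e_n^*(x)\neq 0\}$,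 $\|x\|_\infty=\max_n|e_n^*(x)|$. For $A\in\mathbb{N}^{<\infty}$, $P_A(x)=\sum_{n\in A}e_n^*(x)e_n$. A sign is a sequence $\varepsilon=(\varepsilon_n)$ of scalars of modulus $1$; $1_A=\sum_{n\in A}e_n$, $1_{\varepsilon A}=\sum_{n\in A}\varepsilon_ne_n$. $A\sqcup B\sqcup x$ means $A$, $B$, $\mathrm{supp}(x)$ are pairwise disjoint. A finite set $\Lambda\subset\mathbb{N}$ is a greedy set of $x\in X$ if $\min_{n\in\Lambda}|e_n^*(x)|\geqslant\max_{n\notin\Lambda}|e_n^*(x)|$ (the empty set is a greedy set of every $x$). For $m\in\mathbb{N}_0$: $\gamma_m(x)=\sup\{\|x-P_\Lambda(x)\|:\Lambda\text{ is a greedy set of }x,\ |\Lambda|=m\}$; $\sigma_m(x)=\inf\{\|x-\sum_{n\in A}a_ne_n\|:A\subset\mathbb{N},|A|\leqslant m,(a_n)\subset\mathbb{K}\}$; $\widetilde{\sigma}_m(x)=\inf\{\|x-P_A(x)\|:A\subset\mathbb{N},|A|=m\}$. Definitions (each asserts existence of a constant $C\geqslant 1$ such that the inequality holds): quasi-greedy: $\gamma_m(x)\leqslant C\|x\|$ for all $x\in X$, $m\in\mathbb{N}_0$. Almost greedy: $\gamma_m(x)\leqslant C\widetilde{\sigma}_m(x)$ for all $x,m$. $\lambda$-almost greedy: $\gamma_{\lceil\lambda m\rceil}(x)\leqslant C\widetilde{\sigma}_m(x)$ for all $x,m$. $\lambda$-greedy: $\gamma_{\lceil\lambda m\rceil}(x)\leqslant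 C\sigma_m(x)$ for all $x,m$. Democratic: $\|1_A\|\leqslant C\|1_B\|$ for all $A,B\in\mathbb{N}^{<\infty}$ with $|A|=|B|$. $\lambda$-democratic: $\|1_A\|\leqslant C\|1_B\|$ for all $A,B\in\mathbb{N}^{<\infty}$ with $\lambda|A|\leqslant|B|$. SLC (symmetric for largest coefficients): $\|x+1_{\varepsilon A}\|\leqslant C\|x+1_{\delta B}\|$ for all $x\in X$ with $\|x\|_\infty\leqslant 1$, all $A,B\in\mathbb{N}^{<\infty}$ with $|A|=|B|$ and $A\sqcup B\sqcup x$, and all signs $\varepsilon,\delta$. $\lambda$-SLC: the same with $|A|=|B|$ replaced by $\lambda|A|\leqslant|B|$. *)

theory Defs
  imports "HOL-Analysis.Analysis"
begin

section \<open>Banach spaces over the real or complex numbers\<close>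

text \<open>
  The scalars are the elements of a type \<open>'k\<close> which is assumed to be a copy of \<open>real\<close> or
  \<open>complex\<close>, so that both cases are covered by the same definitions.
\<close>

definition isometric_field_iso :: "('k::real_normed_field \<Rightarrow> 'l::real_normed_field) \<Rightarrow> bool"
  where "isometric_field_iso \<phi> \<longleftrightarrow>
    bij \<phi> \<and> linear \<phi> \<and> \<phi> 1 = 1 \<and> (\<forall>a b. \<phi> (a * b) = \<phi> a * \<phi> b) \<and> (\<forall>a. norm (\<phi> a) = norm a)"

definition real_or_complex :: "'k::real_normed_field itself \<Rightarrow> bool"
  where "real_or_complex _ \<longleftrightarrow>
    (\<exists>\<phi> :: 'k \<Rightarrow> real. isometric_field_iso \<phi>) \<or> (\<exists>\<phi> :: 'k \<Rightarrow> complex. isometric_field_iso \<phi>)"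

locale infdim_banach_space = vector_space smul
  for smul :: "'k::real_normed_field \<Rightarrow> 'a::banach \<Rightarrow> 'a" +
  assumes scalars: "real_or_complex TYPE('k)"
    and norm_scale: "norm (smul c x) = norm c * norm x"
    and scale_of_real: "smul (of_real r) x = r *\<^sub>R x"
    and infinite_dimensional: "\<nexists>S. finite S \<and> span S = UNIV"

definition dual_space :: "('k::real_normed_field \<Rightarrow> 'a::banach \<Rightarrow> 'a) \<Rightarrow> ('a \<Rightarrow> 'k) set"
  where "dual_space smul = {f. bounded_linear f \<and> (\<forall>c x. f (smul c x) = c * f x)}"

definition weak_star_topology ::
    "('k::real_normed_field \<Rightarrow> 'a::banach \<Rightarrow> 'a) \<Rightarrow> ('a \<Rightarrow> 'k) topology"
  where "weak_star_topology smul =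
    subtopology (product_topology (\<lambda>_. euclidean) UNIV) (dual_space smul)"

definition functional_span :: "(nat \<Rightarrow> 'a \<Rightarrow> 'k::real_normed_field) \<Rightarrow> ('a \<Rightarrow> 'k) set"
  where "functional_span f = {(\<lambda>x. \<Sum>n\<in>A. a n * f n x) | A a. finite A}"


section \<open>Bases\<close>

text \<open>Sequences are indexed from \<open>0\<close> instead of \<open>1\<close>; no notion below depends on the order of
  the indices.\<close>

definition biorthogonal ::
    "('k::real_normed_field \<Rightarrow> 'a::banach \<Rightarrow> 'a) \<Rightarrow> (nat \<Rightarrow> 'a) \<Rightarrow> (nat \<Rightarrow> 'a \<Rightarrow> 'k) \<Rightarrow> bool"
  where "biorthogonal smul e f \<longleftrightarrow>
    (\<forall>n. f n \<in> dual_space smul) \<and> (\<forall>i j. f i (e j) = (if i = j then 1 else 0))"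

definition coord ::
    "('k::real_normed_field \<Rightarrow> 'a::banach \<Rightarrow> 'a) \<Rightarrow> (nat \<Rightarrow> 'a) \<Rightarrow> nat \<Rightarrow> 'a \<Rightarrow> 'k"
  where "coord smul e = (THE f. biorthogonal smul e f)"

definition is_basis :: "('k::real_normed_field \<Rightarrow> 'a::banach \<Rightarrow> 'a) \<Rightarrow> (nat \<Rightarrow> 'a) \<Rightarrow> bool"
  where "is_basis smul e \<longleftrightarrow>
    (\<exists>!f. biorthogonal smul e f) \<and>
    bdd_above (range (\<lambda>n. norm (e n) * onorm (coord smul e n))) \<and>
    0 < (INF n. norm (e n)) \<and> bdd_above (range (\<lambda>n. norm (e n))) \<and>
    closure (module.span smul (range e)) = UNIV \<and>
    weak_star_topology smul closure_of functional_span (coord smul e) = dual_space smul"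

definition supp ::
    "('k::real_normed_field \<Rightarrow> 'a::banach \<Rightarrow> 'a) \<Rightarrow> (nat \<Rightarrow> 'a) \<Rightarrow> 'a \<Rightarrow> nat set"
  where "supp smul e x = {n. coord smul e n x \<noteq> 0}"

text \<open>For a basis the coordinates of a vector tend to \<open>0\<close>, so that this supremum is a maximum.\<close>

definition coord_sup_norm ::
    "('k::real_normed_field \<Rightarrow> 'a::banach \<Rightarrow> 'a) \<Rightarrow> (nat \<Rightarrow> 'a) \<Rightarrow> 'a \<Rightarrow> real"
  where "coord_sup_norm smul e x = (SUP n. norm (coord smul e n x))"

definition coord_proj ::
    "('k::real_normed_field \<Rightarrow> 'a::banach \<Rightarrow> 'a) \<Rightarrow> (nat \<Rightarrow> 'a) \<Rightarrow> nat set \<Rightarrow> 'a \<Rightarrow> 'a"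
  where "coord_proj smul e A x = (\<Sum>n\<in>A. smul (coord smul e n x) (e n))"

definition is_sign :: "(nat \<Rightarrow> 'k::real_normed_field) \<Rightarrow> bool"
  where "is_sign \<epsilon> \<longleftrightarrow> (\<forall>n. norm (\<epsilon> n) = 1)"

definition indic_sum :: "(nat \<Rightarrow> 'a::banach) \<Rightarrow> nat set \<Rightarrow> 'a"
  where "indic_sum e A = (\<Sum>n\<in>A. e n)"

definition signed_indic_sum ::
    "('k::real_normed_field \<Rightarrow> 'a::banach \<Rightarrow> 'a) \<Rightarrow> (nat \<Rightarrow> 'a) \<Rightarrow> (nat \<Rightarrow> 'k) \<Rightarrow> nat set \<Rightarrow> 'a"
  where "signed_indic_sum smul e \<epsilon> A = (\<Sum>n\<in>A. smul (\<epsilon> n) (e n))"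


section \<open>Greedy sets and approximation errors\<close>

definition greedy_set ::
    "('k::real_normed_field \<Rightarrow> 'a::banach \<Rightarrow> 'a) \<Rightarrow> (nat \<Rightarrow> 'a) \<Rightarrow> 'a \<Rightarrow> nat set \<Rightarrow> bool"
  where "greedy_set smul e x \<Lambda> \<longleftrightarrow>
    finite \<Lambda> \<and> (\<forall>n\<in>\<Lambda>. \<forall>k\<in>-\<Lambda>. norm (coord smul e k x) \<le> norm (coord smul e n x))"

text \<open>
  The supremum defining \<open>greedy_error\<close> ranges over a finite nonempty set of reals: either every
  greedy set of cardinality \<open>m\<close> contains the support of \<open>x\<close> and the only value is \<open>0\<close>, or there
  are only finitely many such greedy sets, since the coordinates of \<open>x\<close> tend to \<open>0\<close>.
\<close>

definition greedy_error ::
    "('k::real_normed_field \<Rightarrow> 'a::banach \<Rightarrow> 'a) \<Rightarrow> (nat \<Rightarrow> 'a) \<Rightarrow> nat \<Rightarrow> 'a \<Rightarrow> real"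
  where "greedy_error smul e m x =
    Sup {norm (x - coord_proj smul e \<Lambda> x) | \<Lambda>. greedy_set smul e x \<Lambda> \<and> card \<Lambda> = m}"

definition best_error ::
    "('k::real_normed_field \<Rightarrow> 'a::banach \<Rightarrow> 'a) \<Rightarrow> (nat \<Rightarrow> 'a) \<Rightarrow> nat \<Rightarrow> 'a \<Rightarrow> real"
  where "best_error smul e m x =
    Inf {norm (x - (\<Sum>n\<in>A. smul (a n) (e n))) | A a. finite A \<and> card A \<le> m}"

definition best_proj_error ::
    "('k::real_normed_field \<Rightarrow> 'a::banach \<Rightarrow> 'a) \<Rightarrow> (nat \<Rightarrow> 'a) \<Rightarrow> nat \<Rightarrow> 'a \<Rightarrow> real"
  where "best_proj_error smul e m x =
    Inf {norm (x - coord_proj smul e A x) | A. finite A \<and> card A = m}"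


section \<open>Greedy-type properties\<close>

definition quasi_greedy ::
    "('k::real_normed_field \<Rightarrow> 'a::banach \<Rightarrow> 'a) \<Rightarrow> (nat \<Rightarrow> 'a) \<Rightarrow> bool"
  where "quasi_greedy smul e \<longleftrightarrow> (\<exists>C\<ge>1. \<forall>x m. greedy_error smul e m x \<le> C * norm x)"

definition almost_greedy ::
    "('k::real_normed_field \<Rightarrow> 'a::banach \<Rightarrow> 'a) \<Rightarrow> (nat \<Rightarrow> 'a) \<Rightarrow> bool"
  where "almost_greedy smul e \<longleftrightarrow>
    (\<exists>C\<ge>1. \<forall>x m. greedy_error smul e m x \<le> C * best_proj_error smul e m x)"

definition lam_almost_greedy ::
    "real \<Rightarrow> ('k::real_normed_field \<Rightarrow> 'a::banach \<Rightarrow> 'a) \<Rightarrow> (nat \<Rightarrow> 'a) \<Rightarrow> bool"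
  where "lam_almost_greedy l smul e \<longleftrightarrow>
    (\<exists>C\<ge>1. \<forall>x m. greedy_error smul e (nat \<lceil>l * real m\<rceil>) x \<le> C * best_proj_error smul e m x)"

definition lam_greedy ::
    "real \<Rightarrow> ('k::real_normed_field \<Rightarrow> 'a::banach \<Rightarrow> 'a) \<Rightarrow> (nat \<Rightarrow> 'a) \<Rightarrow> bool"
  where "lam_greedy l smul e \<longleftrightarrow>
    (\<exists>C\<ge>1. \<forall>x m. greedy_error smul e (nat \<lceil>l * real m\<rceil>) x \<le> C * best_error smul e m x)"

definition democratic :: "(nat \<Rightarrow> 'a::banach) \<Rightarrow> bool"
  where "democratic e \<longleftrightarrow>
    (\<exists>C\<ge>1. \<forall>A B. finite A \<and> finite B \<and> card A = card B \<longrightarrow>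
      norm (indic_sum e A) \<le> C * norm (indic_sum e B))"

definition lam_democratic :: "real \<Rightarrow> (nat \<Rightarrow> 'a::banach) \<Rightarrow> bool"
  where "lam_democratic l e \<longleftrightarrow>
    (\<exists>C\<ge>1. \<forall>A B. finite A \<and> finite B \<and> l * real (card A) \<le> real (card B) \<longrightarrow>
      norm (indic_sum e A) \<le> C * norm (indic_sum e B))"

definition SLC :: "('k::real_normed_field \<Rightarrow> 'a::banach \<Rightarrow> 'a) \<Rightarrow> (nat \<Rightarrow> 'a) \<Rightarrow> bool"
  where "SLC smul e \<longleftrightarrow>
    (\<exists>C\<ge>1. \<forall>x A B \<epsilon> \<delta>.
      coord_sup_norm smul e x \<le> 1 \<and> finite A \<and> finite B \<and> card A = card B \<and>
      A \<inter> B = {} \<and> A \<inter> supp smul e x = {} \<and> B \<inter> supp smul e x = {} \<and>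
      is_sign \<epsilon> \<and> is_sign \<delta> \<longrightarrow>
      norm (x + signed_indic_sum smul e \<epsilon> A) \<le> C * norm (x + signed_indic_sum smul e \<delta> B))"

definition lam_SLC ::
    "real \<Rightarrow> ('k::real_normed_field \<Rightarrow> 'a::banach \<Rightarrow> 'a) \<Rightarrow> (nat \<Rightarrow> 'a) \<Rightarrow> bool"
  where "lam_SLC l smul e \<longleftrightarrow>
    (\<exists>C\<ge>1. \<forall>x A B \<epsilon> \<delta>.
      coord_sup_norm smul e x \<le> 1 \<and> finite A \<and> finite B \<and>
      l * real (card A) \<le> real (card B) \<and>
      A \<inter> B = {} \<and> A \<inter> supp smul e x = {} \<and> B \<inter> supp smul e x = {} \<and>
      is_sign \<epsilon> \<and> is_sign \<delta> \<longrightarrow>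
      norm (x + signed_indic_sum smul e \<epsilon> A) \<le> C * norm (x + signed_indic_sum smul e \<delta> B))"

definition all_equivalent :: "bool list \<Rightarrow> bool"
  where "all_equivalent Ps \<longleftrightarrow> (\<forall>P\<in>set Ps. \<forall>Q\<in>set Ps. P \<longleftrightarrow> Q)"

end

theory Submission
  imports Defs
begin

text \<open>
  Write \<open>1\<^sub>A\<close> for the sum of the basis vectors with index in \<open>A\<close>. All eleven properties are compared
  with a single one, \<open>strongly_greedy\<close>: the basis is quasi-greedy, and for every \<open>M\<close> the norm of \<open>1\<^sub>A\<close> is
  at most a constant times the norm of \<open>1\<^sub>B\<close> as soon as \<open>|A| \<le> M |B|\<close>.

  Each of the properties implies a very weak form of this: quasi-greediness, together with a bound of
  \<open>1\<^sub>A\<close> by \<open>1\<^sub>B\<close> for disjoint \<open>A\<close>, \<open>B\<close> with \<open>|B| = \<lceil>\<lambda> |A|\<rceil>\<close> for one \<open>\<lambda> \<ge> 1\<close>. For the properties that bound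
  the greedy error, test them on \<open>1\<^sub>A + 1\<^sub>B\<close>, of which \<open>B\<close> is a greedy set; they give quasi-greediness
  because the competing error is at most the norm of the vector, and because the cardinalities
  \<open>\<lceil>\<lambda> m\<rceil>\<close> leave only gaps of bounded length. The weak form implies the strong one
  (\<open>proportional_democracy\<close>): pass from \<open>A\<close> to \<open>B\<close> through a third set far away to get rid of
  disjointness, and cut \<open>A\<close> into a bounded number of small pieces to get rid of \<open>\<lambda>\<close>.

  Conversely, in a quasi-greedy basis the sums over greedy sets are bounded operations, and summation
  by parts (\<open>layer_cake_bound\<close>) turns this into two estimates: multiplying the coefficients of a sum by
  scalars of modulus at most \<open>1\<close> costs a constant as soon as all partial sums are controlled
  (\<open>multiplier_bound\<close>), and a vector whose coefficients on a greedy set \<open>L\<close> have modulus at least \<open>a\<close> has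
  norm at least a constant times the norm of \<open>a 1\<^sub>L\<close> (\<open>ones_le_of_greedy\<close>). Now compare the greedy
  remainder \<open>x - P\<^sub>L x\<close> with an arbitrary competitor \<open>y = x - (\<Sum>n\<in>A. a\<^sub>n e\<^sub>n)\<close>. The two differ by
  the projection of \<open>y\<close> onto a greedy set \<open>G\<close>, and by vectors supported in \<open>A\<close> whose coefficients are at most
  those of \<open>y\<close> on \<open>G\<close>. The former is controlled by quasi-greediness; the latter are controlled by
  \<open>1\<^sub>G\<close> because \<open>G\<close> is not much smaller than \<open>A\<close>, and hence by \<open>y\<close> (\<open>greedy_comparison\<close>).
\<close>

section \<open>Layer-cake sums\<close>

text \<open>
  Summation by parts without choosing an order: the multiplier \<open>t\<close> is a positive combination, of total
  weight at most \<open>T\<close>, of indicators of its upper level sets. The induction splits off the constant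
  function with value \<open>min t\<close> and discards one index where the minimum is attained. If other indices
  attain it as well, the remaining set is not of the form \<open>{n. s \<le> t n}\<close>; hence the weaker condition on \<open>B\<close>,
  which does not separate indices with equal values.
\<close>

lemma layer_cake_bound:
  fixes y :: "'i \<Rightarrow> 'b::real_normed_vector" and t :: "'i \<Rightarrow> real"
  assumes "finite A"
    and "\<And>n. n \<in> A \<Longrightarrow> 0 \<le> t n" "\<And>n. n \<in> A \<Longrightarrow> t n \<le> T" "0 \<le> T"
    and "\<And>B. B \<subseteq> A \<Longrightarrow> (\<forall>n\<in>B. \<forall>k\<in>A - B. t k \<le> t n) \<Longrightarrow> norm (\<Sum>n\<in>B. y n) \<le> M"
  shows "norm (\<Sum>n\<in>A. t n *\<^sub>R y n) \<le> T * M"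
  using assms
proof (induction "card A" arbitrary: A t T)
  case 0
  have "0 \<le> M" using 0(6)[of "{}"] by simp
  then show ?case using 0 by simp
next
  case (Suc c)
  have ne: "A \<noteq> {}" using Suc.hyps by auto
  obtain m where m: "m \<in> A" "\<And>n. n \<in> A \<Longrightarrow> t m \<le> t n"
    using ex_is_arg_min_if_finite[OF Suc.prems(1) ne, of t]
    unfolding is_arg_min_linorder by blast
  have step: "norm (\<Sum>n\<in>A - {m}. (t n - t m) *\<^sub>R y n) \<le> (T - t m) * M"
  proof (rule Suc.hyps(1))
    show "c = card (A - {m})" using Suc.hyps(2) m(1) Suc.prems(1) by simp
    fix B assume B: "B \<subseteq> A - {m}" "\<forall>n\<in>B. \<forall>k\<in>A - {m} - B. t k - t m \<le> t n - t m"
    show "norm (\<Sum>n\<in>B. y n) \<le> M"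
    proof (rule Suc.prems(5))
      show "\<forall>n\<in>B. \<forall>k\<in>A - B. t k \<le> t n"
      proof (intro ballI)
        fix n k assume "n \<in> B" "k \<in> A - B"
        then show "t k \<le> t n" using B m(2)[of n] by (cases "k = m") auto
      qed
    qed (use B in auto)
  qed (use Suc.prems m in auto)
  have "norm (\<Sum>n\<in>A. y n) \<le> M" by (rule Suc.prems(5)) auto
  then have "t m * norm (\<Sum>n\<in>A. y n) \<le> t m * M"
    using Suc.prems(2)[OF m(1)] by (rule mult_left_mono)
  then have base: "norm (t m *\<^sub>R (\<Sum>n\<in>A. y n)) \<le> t m * M"
    using Suc.prems(2)[OF m(1)] by simp
  have "(\<Sum>n\<in>A. t n *\<^sub>R y n) = t m *\<^sub>R (\<Sum>n\<in>A. y n) + (\<Sum>n\<in>A. (t n - t m) *\<^sub>R y n)"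
    by (simp add: scaleR_sum_right scaleR_diff_left sum_subtractf)
  also have "(\<Sum>n\<in>A. (t n - t m) *\<^sub>R y n) = (\<Sum>n\<in>A - {m}. (t n - t m) *\<^sub>R y n)"
    using Suc.prems(1) m(1) by (simp add: sum.remove)
  finally show ?case
    using base step norm_triangle_ineq[of "t m *\<^sub>R (\<Sum>n\<in>A. y n)" "\<Sum>n\<in>A - {m}. (t n - t m) *\<^sub>R y n"]
    by (simp add: algebra_simps)
qed

section \<open>Coordinates and greedy sets\<close>

locale basis_setting = infdim_banach_space smul
  for smul :: "'k::real_normed_field \<Rightarrow> 'a::banach \<Rightarrow> 'a" (infixr "*\<^sub>K" 75) +
  fixes e :: "nat \<Rightarrow> 'a"
  assumes basis: "is_basis smul e"
begin

abbreviation coef :: "nat \<Rightarrow> 'a \<Rightarrow> 'k" where "coef n x \<equiv> coord smul e n x"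
abbreviation proj :: "nat set \<Rightarrow> 'a \<Rightarrow> 'a" where "proj A x \<equiv> coord_proj smul e A x"
abbreviation greedy :: "'a \<Rightarrow> nat set \<Rightarrow> bool" where "greedy x L \<equiv> greedy_set smul e x L"
abbreviation ones :: "nat set \<Rightarrow> 'a" where "ones A \<equiv> indic_sum e A"

lemma biorthogonal_coord: "biorthogonal smul e (coord smul e)"
proof -
  have "\<exists>!f. biorthogonal smul e f" using basis by (simp add: is_basis_def)
  then show ?thesis unfolding coord_def by (rule theI')
qed

lemma bounded_linear_coef: "bounded_linear (coord smul e n)"
  using biorthogonal_coord by (auto simp: biorthogonal_def dual_space_def)

lemma coef_scale [simp]: "coef n (c *\<^sub>K x) = c * coef n x"
  using biorthogonal_coord by (auto simp: biorthogonal_def dual_space_def)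

lemma coef_basis [simp]: "coef i (e j) = (if i = j then 1 else 0)"
  using biorthogonal_coord by (auto simp: biorthogonal_def)

lemma coef_add [simp]: "coef n (x + y) = coef n x + coef n y"
  and coef_diff [simp]: "coef n (x - y) = coef n x - coef n y"
  and coef_zero [simp]: "coef n 0 = 0"
  and coef_sum: "coef n (sum g A) = (\<Sum>i\<in>A. coef n (g i))"
  using bounded_linear_coef[of n]
  by (simp_all add: bounded_linear.linear linear_add linear_diff linear_0 linear_sum)

lemma coef_lincomb [simp]:
  "finite A \<Longrightarrow> coef n (\<Sum>k\<in>A. a k *\<^sub>K e k) = (if n \<in> A then a n else 0)"
  by (simp add: coef_sum if_distrib cong: if_cong)

lemma coef_proj [simp]: "finite A \<Longrightarrow> coef n (proj A x) = (if n \<in> A then coef n x else 0)"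
  by (simp add: coord_proj_def)

lemma coef_ones [simp]: "finite A \<Longrightarrow> coef n (ones A) = (if n \<in> A then 1 else 0)"
  by (simp add: indic_sum_def coef_sum)

lemma proj_diff_vector: "proj A (x - y) = proj A x - proj A y"
  by (simp add: coord_proj_def scale_left_diff_distrib sum_subtractf)

lemma proj_Un: "finite A \<Longrightarrow> finite B \<Longrightarrow> A \<inter> B = {} \<Longrightarrow> proj (A \<union> B) x = proj A x + proj B x"
  by (simp add: coord_proj_def sum.union_disjoint)

lemma proj_diff_set: "finite A \<Longrightarrow> B \<subseteq> A \<Longrightarrow> proj (A - B) x = proj A x - proj B x"
  by (simp add: coord_proj_def sum_diff)

lemma proj_lincomb: "finite A \<Longrightarrow> finite B \<Longrightarrow>
    proj B (\<Sum>k\<in>A. a k *\<^sub>K e k) = (\<Sum>k\<in>A \<inter> B. a k *\<^sub>K e k)"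
  unfolding coord_proj_def by (rule sum.mono_neutral_cong_right) auto

lemma proj_ones: "finite A \<Longrightarrow> B \<subseteq> A \<Longrightarrow> proj B (ones A) = ones B"
  by (auto simp: coord_proj_def indic_sum_def coef_sum intro!: sum.cong)

lemma norm_basis_bounded:
  obtains E where "E > 0" "\<And>n. norm (e n) \<le> E"
proof -
  obtain E where E: "\<And>n. norm (e n) \<le> E"
    using basis by (auto simp: is_basis_def bdd_above_def)
  show ?thesis by (rule that[of "max E 1"]) (auto intro: order_trans[OF E])
qed

text \<open>
  The bound on the products of the norms of \<open>e\<^sub>n\<close> and of its coordinate functional, and the positive
  lower bound on the norms of the \<open>e\<^sub>n\<close>, bound the functionals uniformly.
\<close>

lemma coef_bounded:
  obtains F where "F > 0" "\<And>n x. norm (coef n x) \<le> F * norm x"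
proof -
  define i where "i = (INF n. norm (e n))"
  have i: "i > 0" using basis by (simp add: is_basis_def i_def)
  have ile: "i \<le> norm (e n)" for n
    unfolding i_def by (rule cINF_lower) (auto intro!: bdd_belowI[of _ 0])
  obtain K where K: "\<And>n. norm (e n) * onorm (coord smul e n) \<le> K"
    using basis by (auto simp: is_basis_def bdd_above_def)
  have o: "onorm (coord smul e n) \<le> max 1 (K / i)" for n
  proof -
    have "i * onorm (coord smul e n) \<le> norm (e n) * onorm (coord smul e n)"
      using ile onorm_pos_le[OF bounded_linear_coef] by (intro mult_right_mono) auto
    then have "i * onorm (coord smul e n) \<le> K" using K order_trans by blast
    then have "onorm (coord smul e n) \<le> K / i" using i by (simp add: field_simps)
    then show ?thesis by simp
  qed
  have "norm (coef n x) \<le> max 1 (K / i) * norm x" for n x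
    using onorm[OF bounded_linear_coef, of n x] mult_right_mono[OF o[of n], of "norm x"] by simp
  then show ?thesis by (rule that[rotated]) simp
qed

lemma finite_support_span:
  assumes "y \<in> module.span smul (range e)"
  shows "finite {n. coef n y \<noteq> 0}"
  using assms
proof (induction rule: span_induct_alt)
  case base
  then show ?case by simp
next
  case (step c x y)
  then obtain k where "x = e k" by auto
  then have "{n. coef n (c *\<^sub>K x + y) \<noteq> 0} \<subseteq> insert k {n. coef n y \<noteq> 0}" by auto
  with step.IH show ?case by (meson finite.insertI finite_subset)
qed

text \<open>
  The coordinates of a vector tend to \<open>0\<close>: this is clear on the dense span of the basis, and passes to
  the closure because the coordinate functionals are uniformly bounded.
\<close>

lemma finite_large_coefs:
  assumes "\<eta> > 0"
  shows "finite {n. \<eta> \<le> norm (coef n x)}"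
proof -
  obtain F where F: "F > 0" "\<And>n x. norm (coef n x) \<le> F * norm x" by (rule coef_bounded) auto
  have "x \<in> closure (module.span smul (range e))" using basis by (simp add: is_basis_def)
  then obtain y where y: "y \<in> module.span smul (range e)" "dist y x < \<eta> / F"
    using assms F by (metis closure_approachable divide_pos_pos)
  have "coef n y \<noteq> 0" if "\<eta> \<le> norm (coef n x)" for n
  proof
    assume "coef n y = 0"
    then have "norm (coef n x) \<le> F * norm (x - y)" using F(2)[of n "x - y"] by simp
    also have "\<dots> < \<eta>" using y(2) F(1) by (simp add: dist_norm norm_minus_commute field_simps)
    finally show False using that by simp
  qed
  then have "{n. \<eta> \<le> norm (coef n x)} \<subseteq> {n. coef n y \<noteq> 0}" by auto
  then show ?thesis using finite_support_span[OF y(1)] finite_subset by blast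
qed

lemma largest_coef:
  assumes "S \<noteq> {}"
  obtains n where "n \<in> S" "\<And>k. k \<in> S \<Longrightarrow> norm (coef k x) \<le> norm (coef n x)"
proof (cases "\<forall>k\<in>S. coef k x = 0")
  case True
  then show ?thesis using assms that by fastforce
next
  case False
  then obtain k0 where k0: "k0 \<in> S" "coef k0 x \<noteq> 0" by auto
  define U where "U = {n \<in> S. norm (coef k0 x) \<le> norm (coef n x)}"
  have "finite U" unfolding U_def
    by (rule finite_subset[OF _ finite_large_coefs[of "norm (coef k0 x)" x]]) (use k0 in auto)
  moreover have "U \<noteq> {}" using k0 by (auto simp: U_def)
  ultimately obtain n where n: "n \<in> U" "\<And>k. k \<in> U \<Longrightarrow> norm (coef k x) \<le> norm (coef n x)"
    using ex_is_arg_min_if_finite[of U "\<lambda>n. - norm (coef n x)"]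
    unfolding is_arg_min_linorder neg_le_iff_le by blast
  show ?thesis
  proof (rule that[of n])
    show "n \<in> S" using n by (auto simp: U_def)
    fix k assume "k \<in> S"
    show "norm (coef k x) \<le> norm (coef n x)"
    proof (cases "k \<in> U")
      case False
      then have "norm (coef k x) \<le> norm (coef k0 x)" using \<open>k \<in> S\<close> by (auto simp: U_def)
      also have "\<dots> \<le> norm (coef n x)" using n(1) by (auto simp: U_def)
      finally show ?thesis .
    qed (use n in auto)
  qed
qed

lemma greedy_finite: "greedy x L \<Longrightarrow> finite L"
  by (simp add: greedy_set_def)

lemma greedyD: "greedy x L \<Longrightarrow> n \<in> L \<Longrightarrow> k \<notin> L \<Longrightarrow> norm (coef k x) \<le> norm (coef n x)"
  by (simp add: greedy_set_def)

lemma greedyI: "finite L \<Longrightarrow> (\<And>n k. n \<in> L \<Longrightarrow> k \<notin> L \<Longrightarrow> norm (coef k x) \<le> norm (coef n x)) \<Longrightarrow> greedy x L"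
  by (simp add: greedy_set_def)

lemma greedy_set_exists: "\<exists>L. greedy x L \<and> card L = m"
proof (induction m)
  case 0
  show ?case by (rule exI[of _ "{}"]) (simp add: greedy_set_def)
next
  case (Suc m)
  then obtain L where L: "greedy x L" "card L = m" by blast
  have fin: "finite L" using L greedy_finite by blast
  then have "- L \<noteq> {}" using finite_compl by fastforce
  then obtain n where n: "n \<in> - L" "\<And>k. k \<in> - L \<Longrightarrow> norm (coef k x) \<le> norm (coef n x)"
    using largest_coef[of "- L" x] by metis
  have "greedy x (insert n L)"
    by (rule greedyI) (use fin n greedyD[OF L(1)] in auto)
  then show ?case using n(1) fin L(2) by (intro exI[of _ "insert n L"]) simp
qed

lemma greedy_subset_exists:
  assumes "greedy x L" "j \<le> card L"
  shows "\<exists>G\<subseteq>L. greedy x G \<and> card G = j"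
  using assms
proof (induction "card L - j" arbitrary: L)
  case 0
  then show ?case by (intro exI[of _ L]) simp
next
  case (Suc c)
  have fin: "finite L" using Suc.prems(1) greedy_finite by blast
  have "L \<noteq> {}" using Suc.hyps(2) by auto
  then obtain m where m: "m \<in> L" "\<And>n. n \<in> L \<Longrightarrow> norm (coef m x) \<le> norm (coef n x)"
    using ex_is_arg_min_if_finite[OF fin, of "\<lambda>n. norm (coef n x)"]
    unfolding is_arg_min_linorder by blast
  have g: "greedy x (L - {m})"
    by (rule greedyI) (use fin m greedyD[OF Suc.prems(1)] in auto)
  have "\<exists>G\<subseteq>L - {m}. greedy x G \<and> card G = j"
    by (rule Suc.hyps(1)[OF _ g]) (use Suc.hyps(2) m fin in auto)
  then show ?case by blast
qed

section \<open>The approximation errors\<close>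

lemma norm_proj_le:
  obtains K where "K > 0" "\<And>A x. finite A \<Longrightarrow> norm (proj A x) \<le> real (card A) * K * norm x"
proof -
  obtain F where F: "F > 0" "\<And>n x. norm (coef n x) \<le> F * norm x" by (rule coef_bounded) auto
  obtain E where E: "E > 0" "\<And>n. norm (e n) \<le> E" by (rule norm_basis_bounded) auto
  have *: "norm (coef n x *\<^sub>K e n) \<le> F * E * norm x" for n x
    using mult_mono[OF F(2)[of n x] E(2)[of n]] F(1) by (simp add: norm_scale mult_ac)
  have "norm (proj A x) \<le> real (card A) * (F * E) * norm x" if "finite A" for A x
    unfolding coord_proj_def using sum_norm_bound[of A "\<lambda>n. coef n x *\<^sub>K e n", OF *] by (simp add: mult_ac)
  then show ?thesis using that[of "F * E"] F(1) E(1) by simp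
qed

text \<open>
  The supremum in \<open>greedy_error\<close> ranges over a nonempty bounded set, so that it has its intended meaning.
\<close>

lemma greedy_error_le_iff:
  "greedy_error smul e m x \<le> c \<longleftrightarrow>
    (\<forall>L. greedy x L \<and> card L = m \<longrightarrow> norm (x - proj L x) \<le> c)"
proof -
  obtain K where K: "K > 0" "\<And>A x. finite A \<Longrightarrow> norm (proj A x) \<le> real (card A) * K * norm x"
    by (rule norm_proj_le) auto
  let ?S = "{norm (x - proj L x) | L. greedy x L \<and> card L = m}"
  have "?S \<noteq> {}" using greedy_set_exists[of x m] by blast
  moreover have "bdd_above ?S"
  proof (rule bdd_aboveI)
    fix r assume "r \<in> ?S"
    then obtain L where L: "r = norm (x - proj L x)" "greedy x L" "card L = m" by blast
    show "r \<le> norm x + real m * K * norm x"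
      using norm_triangle_ineq4[of x "proj L x"] K(2)[of L x] greedy_finite[OF L(2)] L by auto
  qed
  ultimately show ?thesis
    unfolding greedy_error_def by (subst cSup_le_iff) auto
qed

lemma quasi_greedy_iff:
  "quasi_greedy smul e \<longleftrightarrow> (\<exists>C\<ge>1. \<forall>x L. greedy x L \<longrightarrow> norm (x - proj L x) \<le> C * norm x)"
  unfolding quasi_greedy_def greedy_error_le_iff by auto

lemma best_error_le:
  assumes "finite A" "card A \<le> m"
  shows "best_error smul e m x \<le> norm (x - (\<Sum>n\<in>A. a n *\<^sub>K e n))"
  unfolding best_error_def
  by (rule cInf_lower) (use assms in \<open>auto intro!: bdd_belowI[of _ 0]\<close>)

lemma best_proj_error_le:
  assumes "finite A" "card A = m"
  shows "best_proj_error smul e m x \<le> norm (x - proj A x)"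
  unfolding best_proj_error_def
  by (rule cInf_lower) (use assms in \<open>auto intro!: bdd_belowI[of _ 0]\<close>)

lemma le_mult_best_error:
  assumes "C > 0" "\<And>A a. finite A \<Longrightarrow> card A \<le> m \<Longrightarrow> r \<le> C * norm (x - (\<Sum>n\<in>A. a n *\<^sub>K e n))"
  shows "r \<le> C * best_error smul e m x"
proof -
  have "r / C \<le> best_error smul e m x"
    unfolding best_error_def
  proof (rule cInf_greatest)
    show "{norm (x - (\<Sum>n\<in>A. a n *\<^sub>K e n)) |A a. finite A \<and> card A \<le> m} \<noteq> {}"
      by (auto intro!: exI[of _ "{}"])
    fix q assume "q \<in> {norm (x - (\<Sum>n\<in>A. a n *\<^sub>K e n)) |A a. finite A \<and> card A \<le> m}"
    then obtain A a where "finite A" "card A \<le> m" "q = norm (x - (\<Sum>n\<in>A. a n *\<^sub>K e n))" by blast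
    then show "r / C \<le> q" using assms(2)[of A a] assms(1) by (simp add: divide_le_eq mult.commute)
  qed
  then show ?thesis using assms(1) by (simp add: field_simps)
qed

lemma le_mult_best_proj_error:
  assumes "C > 0" "\<And>A. finite A \<Longrightarrow> card A = m \<Longrightarrow> r \<le> C * norm (x - proj A x)"
  shows "r \<le> C * best_proj_error smul e m x"
proof -
  have "r / C \<le> best_proj_error smul e m x"
    unfolding best_proj_error_def
  proof (rule cInf_greatest)
    show "{norm (x - proj A x) |A. finite A \<and> card A = m} \<noteq> {}"
      by (auto intro!: exI[of _ "{..<m}"])
    fix q assume "q \<in> {norm (x - proj A x) |A. finite A \<and> card A = m}"
    then obtain A where "finite A" "card A = m" "q = norm (x - proj A x)" by blast
    then show "r / C \<le> q" using assms(2)[of A] assms(1) by (simp add: divide_le_eq mult.commute)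
  qed
  then show ?thesis using assms(1) by (simp add: field_simps)
qed

text \<open>
  Project onto \<open>m\<close> indices at which the coordinates of \<open>x\<close> are negligible.
\<close>

lemma best_proj_error_le_norm: "best_proj_error smul e m x \<le> norm x"
proof (rule field_le_epsilon)
  fix \<epsilon> :: real assume \<epsilon>: "\<epsilon> > 0"
  obtain E where E: "E > 0" "\<And>n. norm (e n) \<le> E" by (rule norm_basis_bounded) auto
  \<comment> \<open>\<open>m\<close> terms of norm at most \<open>\<eta> E\<close> add up to at most \<open>\<epsilon>\<close>\<close>
  define \<eta> where "\<eta> = \<epsilon> / ((real m + 1) * E)"
  have \<eta>: "\<eta> > 0" using \<epsilon> E by (simp add: \<eta>_def)
  have "infinite (- {n. \<eta> \<le> norm (coef n x)})"
    using finite_large_coefs[OF \<eta>] by (simp add: finite_compl)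
  then obtain A where A: "finite A" "card A = m" "A \<subseteq> - {n. \<eta> \<le> norm (coef n x)}"
    using infinite_arbitrarily_large by blast
  have "norm (coef n x *\<^sub>K e n) \<le> \<eta> * E" if "n \<in> A" for n
    unfolding norm_scale using A(3) that E \<eta> by (intro mult_mono) auto
  then have "norm (proj A x) \<le> real m * (\<eta> * E)"
    unfolding coord_proj_def using sum_norm_bound[of A "\<lambda>n. coef n x *\<^sub>K e n"] A(2) by auto
  also have "\<dots> \<le> \<epsilon>"
  proof -
    have "\<eta> * E = \<epsilon> / (real m + 1)" using E by (simp add: \<eta>_def)
    then show ?thesis using \<epsilon> by (simp add: divide_le_eq)
  qed
  finally have "norm (x - proj A x) \<le> norm x + \<epsilon>"
    using norm_triangle_ineq4[of x "proj A x"] by simp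
  then show "best_proj_error smul e m x \<le> norm x + \<epsilon>"
    using best_proj_error_le[OF A(1,2), of x] by simp
qed

lemma best_error_le_norm: "best_error smul e m x \<le> norm x"
  using best_error_le[of "{}" m x] by simp

text \<open>
  Any cardinality exceeds one of the form \<open>\<lceil>l m\<rceil>\<close> by at most \<open>l\<close>. A greedy set therefore contains a greedy
  set of such a cardinality, and the boundedly many remaining terms are each at most a constant times
  the norm of \<open>x\<close>.
\<close>

lemma quasi_greedy_of_sparse_sizes:
  assumes l: "l \<ge> 1" and C: "C \<ge> 1"
    and sparse: "\<And>x m. greedy_error smul e (nat \<lceil>l * real m\<rceil>) x \<le> C * norm x"
  shows "quasi_greedy smul e"
proof -
  obtain K where K: "K > 0" "\<And>A x. finite A \<Longrightarrow> norm (proj A x) \<le> real (card A) * K * norm x"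
    by (rule norm_proj_le) auto
  have "norm (x - proj L x) \<le> (C + l * K) * norm x" if L: "greedy x L" for x L
  proof -
    have fin: "finite L" using L greedy_finite by blast
    define m where "m = nat \<lfloor>real (card L) / l\<rfloor>"
    define j where "j = nat \<lceil>l * real m\<rceil>"
    have mle: "real m \<le> real (card L) / l" and mgt: "real (card L) / l < real m + 1"
      using l by (auto simp: m_def)
    have "l * real m \<le> real (card L)" using mle l by (simp add: field_simps)
    then have jle: "j \<le> card L" unfolding j_def by linarith
    have "real (card L) \<le> l * real m + l" using mgt l by (simp add: field_simps)
    moreover have "l * real m \<le> real j" unfolding j_def by linarith
    ultimately have jgt: "real (card L - j) \<le> l" using jle by simp
    obtain G where G: "G \<subseteq> L" "greedy x G" "card G = j"
      using greedy_subset_exists[OF L jle] by blast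
    have "norm (x - proj G x) \<le> C * norm x"
      using sparse[of m x] G unfolding greedy_error_le_iff j_def by blast
    moreover have "norm (proj (L - G) x) \<le> l * K * norm x"
    proof -
      have "norm (proj (L - G) x) \<le> real (card (L - G)) * K * norm x" using K fin by simp
      also have "\<dots> \<le> l * K * norm x"
        using jgt K(1) G fin by (intro mult_right_mono) (auto simp: card_Diff_subset finite_subset)
      finally show ?thesis .
    qed
    moreover have "x - proj L x = (x - proj G x) - proj (L - G) x"
      using proj_diff_set[OF fin G(1)] by simp
    ultimately show ?thesis
      using norm_triangle_ineq4[of "x - proj G x" "proj (L - G) x"] by (simp add: algebra_simps)
  qed
  moreover have "C + l * K \<ge> 1" using C l K by (smt (verit) mult_pos_pos)
  ultimately show ?thesis unfolding quasi_greedy_iff by blast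
qed

section \<open>Multipliers\<close>

text \<open>
  A decomposition into real and imaginary parts that treats both scalar fields at once: \<open>j\<close> plays the
  role of the imaginary unit, and over the reals one takes \<open>v = 0\<close>.
\<close>

lemma scalar_split:
  "\<exists>j::'k. norm j = 1 \<and> (\<forall>c::'k. \<exists>u v. \<bar>u\<bar> \<le> norm c \<and> \<bar>v\<bar> \<le> norm c \<and> c = of_real u + j * of_real v)"
  using scalars unfolding real_or_complex_def
proof
  assume "\<exists>\<phi>::'k \<Rightarrow> real. isometric_field_iso \<phi>"
  then obtain \<phi> :: "'k \<Rightarrow> real" where \<phi>: "isometric_field_iso \<phi>" by blast
  then have lin: "linear \<phi>" and one: "\<phi> 1 = 1" and inj: "inj \<phi>" and nm: "\<And>a. norm (\<phi> a) = norm a"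
    by (auto simp: isometric_field_iso_def bij_def)
  have "\<phi> (of_real (\<phi> c)) = \<phi> c" for c :: 'k
    using linear_cmul[OF lin, of "\<phi> c" 1] one by (simp add: of_real_def)
  then have "c = of_real (\<phi> c)" for c :: 'k using inj by (metis injD)
  then have "\<exists>u v. \<bar>u\<bar> \<le> norm c \<and> \<bar>v\<bar> \<le> norm c \<and> c = of_real u + 1 * of_real v" for c :: 'k
    using nm[of c] by (intro exI[of _ "\<phi> c"] exI[of _ 0]) auto
  then show ?thesis by (intro exI[of _ 1]) auto
next
  assume "\<exists>\<phi>::'k \<Rightarrow> complex. isometric_field_iso \<phi>"
  then obtain \<phi> :: "'k \<Rightarrow> complex" where \<phi>: "isometric_field_iso \<phi>" by blast
  then have lin: "linear \<phi>" and one: "\<phi> 1 = 1" and bij: "bij \<phi>" and nm: "\<And>a. norm (\<phi> a) = norm a"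
    and mult: "\<And>a b. \<phi> (a * b) = \<phi> a * \<phi> b"
    by (auto simp: isometric_field_iso_def)
  obtain j where j: "\<phi> j = \<i>" using bij by (metis bij_pointE)
  have re: "\<phi> (of_real r) = of_real r" for r
    using linear_cmul[OF lin, of r 1] one by (simp add: of_real_def)
  have "c = of_real (Re (\<phi> c)) + j * of_real (Im (\<phi> c))" for c :: 'k
  proof -
    have "\<phi> (of_real (Re (\<phi> c)) + j * of_real (Im (\<phi> c))) = \<phi> c"
      by (simp add: linear_add[OF lin] mult re j complex_eq[symmetric])
    then show ?thesis using bij by (metis bij_def injD)
  qed
  moreover have "\<bar>Re (\<phi> c)\<bar> \<le> norm c" "\<bar>Im (\<phi> c)\<bar> \<le> norm c" for c :: 'k
    using abs_Re_le_cmod[of "\<phi> c"] abs_Im_le_cmod[of "\<phi> c"] nm[of c] by auto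
  moreover have "norm j = 1" using nm[of j] j by simp
  ultimately show ?thesis by blast
qed

text \<open>
  Multipliers in \<open>[0, \<alpha>]\<close> are covered by the layer-cake bound. The factor \<open>4\<close> comes from splitting a
  scalar into real and imaginary part, and each of these into positive and negative part.
\<close>

lemma multiplier_bound:
  fixes y :: "'i \<Rightarrow> 'a" and c :: "'i \<Rightarrow> 'k"
  assumes fin: "finite A" and \<alpha>: "0 \<le> \<alpha>"
    and c: "\<And>n. n \<in> A \<Longrightarrow> norm (c n) \<le> \<alpha>"
    and M: "\<And>B. B \<subseteq> A \<Longrightarrow> norm (\<Sum>n\<in>B. y n) \<le> M"
  shows "norm (\<Sum>n\<in>A. c n *\<^sub>K y n) \<le> 4 * \<alpha> * M"
proof -
  have pos: "norm (\<Sum>n\<in>A. t n *\<^sub>R y n) \<le> \<alpha> * M"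
    if "\<And>n. n \<in> A \<Longrightarrow> 0 \<le> t n \<and> t n \<le> \<alpha>" for t
    by (rule layer_cake_bound) (use that fin \<alpha> M in auto)
  have real: "norm (\<Sum>n\<in>A. u n *\<^sub>R y n) \<le> 2 * \<alpha> * M"
    if u: "\<And>n. n \<in> A \<Longrightarrow> \<bar>u n\<bar> \<le> \<alpha>" for u
  proof -
    have eq: "(\<Sum>n\<in>A. u n *\<^sub>R y n) = (\<Sum>n\<in>A. max (u n) 0 *\<^sub>R y n) - (\<Sum>n\<in>A. max (- u n) 0 *\<^sub>R y n)"
      by (auto simp: sum_subtractf[symmetric] scaleR_diff_left[symmetric] intro!: sum.cong)
    have "norm (\<Sum>n\<in>A. max (u n) 0 *\<^sub>R y n) \<le> \<alpha> * M"
      by (rule pos) (use u \<alpha> in \<open>force simp: abs_le_iff\<close>)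
    moreover have "norm (\<Sum>n\<in>A. max (- u n) 0 *\<^sub>R y n) \<le> \<alpha> * M"
      by (rule pos) (use u \<alpha> in \<open>force simp: abs_le_iff\<close>)
    ultimately show ?thesis unfolding eq
      using norm_triangle_ineq4[of "\<Sum>n\<in>A. max (u n) 0 *\<^sub>R y n" "\<Sum>n\<in>A. max (- u n) 0 *\<^sub>R y n"]
      by linarith
  qed
  obtain j :: 'k where j: "norm j = 1"
    "\<forall>c::'k. \<exists>u v. \<bar>u\<bar> \<le> norm c \<and> \<bar>v\<bar> \<le> norm c \<and> c = of_real u + j * of_real v"
    using scalar_split by blast
  then obtain u v where uv: "\<And>c::'k. \<bar>u c\<bar> \<le> norm c" "\<And>c::'k. \<bar>v c\<bar> \<le> norm c"
    "\<And>c::'k. c = of_real (u c) + j * of_real (v c)" by metis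
  have "c n *\<^sub>K y n = u (c n) *\<^sub>R y n + j *\<^sub>K (v (c n) *\<^sub>R y n)" for n
    by (subst uv(3)[of "c n"]) (simp add: scale_left_distrib scale_of_real flip: scale_scale)
  then have "(\<Sum>n\<in>A. c n *\<^sub>K y n) = (\<Sum>n\<in>A. u (c n) *\<^sub>R y n) + j *\<^sub>K (\<Sum>n\<in>A. v (c n) *\<^sub>R y n)"
    by (simp add: sum.distrib scale_sum_right)
  moreover have "norm (\<Sum>n\<in>A. u (c n) *\<^sub>R y n) \<le> 2 * \<alpha> * M"
    by (rule real) (use uv(1) c order_trans in blast)
  moreover have "norm (j *\<^sub>K (\<Sum>n\<in>A. v (c n) *\<^sub>R y n)) \<le> 2 * \<alpha> * M"
    unfolding norm_scale j(1) mult_1 by (rule real) (use uv(2) c order_trans in blast)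
  ultimately show ?thesis
    using norm_triangle_ineq[of "\<Sum>n\<in>A. u (c n) *\<^sub>R y n" "j *\<^sub>K (\<Sum>n\<in>A. v (c n) *\<^sub>R y n)"]
    by simp
qed

lemma lincomb_le_ones:
  assumes fin: "finite A" and \<alpha>: "0 \<le> \<alpha>"
    and c: "\<And>n. n \<in> A \<Longrightarrow> norm (c n) \<le> \<alpha>"
    and M: "\<And>B. B \<subseteq> A \<Longrightarrow> norm (ones B) \<le> M"
  shows "norm (\<Sum>n\<in>A. c n *\<^sub>K e n) \<le> 4 * \<alpha> * M"
  by (rule multiplier_bound[OF fin \<alpha> c M[unfolded indic_sum_def]])

section \<open>Estimates for quasi-greedy bases\<close>

context
  fixes C :: real
  assumes C: "C \<ge> 1" and qg: "\<And>x L. greedy x L \<Longrightarrow> norm (x - proj L x) \<le> C * norm x"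
begin

lemma norm_proj_greedy_diff:
  assumes "greedy x L" "greedy x G" "G \<subseteq> L"
  shows "norm (proj (L - G) x) \<le> 2 * C * norm x"
proof -
  have "proj (L - G) x = (x - proj G x) - (x - proj L x)"
    using assms greedy_finite by (simp add: proj_diff_set)
  then show ?thesis
    using qg[OF assms(1)] qg[OF assms(2)] norm_triangle_ineq4[of "x - proj G x" "x - proj L x"] by simp
qed

text \<open>
  All coefficients of \<open>1\<^sub>A\<close> on \<open>A\<close> are equal, so that every subset of \<open>A\<close>, in particular \<open>A - B\<close>, is a
  greedy set of it.
\<close>

lemma ones_subset_le:
  assumes "finite A" "B \<subseteq> A"
  shows "norm (ones B) \<le> C * norm (ones A)"
proof -
  have "greedy (ones A) (A - B)"
    by (rule greedyI) (use assms in auto)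
  moreover have "ones A - proj (A - B) (ones A) = ones B"
    using assms proj_ones[of A "A - B"] by (simp add: indic_sum_def sum_diff)
  ultimately show ?thesis using qg[of "ones A" "A - B"] by simp
qed

text \<open>
  As all coefficients have the same modulus, every subset of \<open>A\<close> is a greedy set of the signed sum.
  Hence all its partial sums are controlled by the whole, and the signs can be removed by a multiplier.
\<close>

lemma ones_le_signed_sum:
  assumes fin: "finite A" and \<epsilon>: "\<And>n. n \<in> A \<Longrightarrow> norm (\<epsilon> n) = 1"
  shows "norm (ones A) \<le> 8 * C * norm (\<Sum>n\<in>A. \<epsilon> n *\<^sub>K e n)"
proof -
  let ?z = "\<Sum>n\<in>A. \<epsilon> n *\<^sub>K e n"
  have M: "norm (\<Sum>n\<in>B. \<epsilon> n *\<^sub>K e n) \<le> 2 * C * norm ?z" if B: "B \<subseteq> A" for B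
  proof -
    have finB: "finite B" using fin B finite_subset by blast
    have "greedy ?z B" by (rule greedyI) (use B fin finB \<epsilon> in auto)
    moreover have "greedy ?z {}" by (simp add: greedy_set_def)
    ultimately have "norm (proj (B - {}) ?z) \<le> 2 * C * norm ?z"
      by (rule norm_proj_greedy_diff) simp
    moreover have "A \<inter> B = B" using B by auto
    ultimately show ?thesis using proj_lincomb[OF fin finB, of \<epsilon>] by simp
  qed
  have "norm (\<Sum>n\<in>A. inverse (\<epsilon> n) *\<^sub>K (\<epsilon> n *\<^sub>K e n)) \<le> 4 * 1 * (2 * C * norm ?z)"
    by (rule multiplier_bound) (use fin \<epsilon> M in \<open>auto simp: norm_inverse\<close>)
  moreover have "(\<Sum>n\<in>A. inverse (\<epsilon> n) *\<^sub>K (\<epsilon> n *\<^sub>K e n)) = ones A"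
    unfolding indic_sum_def
  proof (rule sum.cong[OF refl])
    fix n assume "n \<in> A"
    then have "\<epsilon> n \<noteq> 0" using \<epsilon> by force
    then show "inverse (\<epsilon> n) *\<^sub>K (\<epsilon> n *\<^sub>K e n) = e n" by simp
  qed
  ultimately show ?thesis by simp
qed

text \<open>
  Truncation at height \<open>a\<close>: multiplying the coefficient of \<open>x\<close> at \<open>n \<in> L\<close> by \<open>t\<^sub>n = a / |x\<^sub>n|\<close> produces \<open>a\<close> times
  a signed sum. The multiplier takes values in \<open>[0, 1]\<close> and increases when \<open>|x\<^sub>n|\<close> decreases, so that each of
  its upper level sets is \<open>L\<close> minus a greedy set of \<open>x\<close>, and the partial sums in question are
  differences of two greedy projections.
\<close>

lemma ones_le_of_greedy:
  assumes L: "greedy x L" and a: "0 \<le> a" "\<And>n. n \<in> L \<Longrightarrow> a \<le> norm (coef n x)"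
  shows "a * norm (ones L) \<le> 16 * C\<^sup>2 * norm x"
proof (cases "a = 0")
  case False
  then have a0: "a > 0" using a by simp
  have fin: "finite L" using L greedy_finite by blast
  have nz: "coef n x \<noteq> 0" if "n \<in> L" for n using a(2)[OF that] a0 by auto
  define \<epsilon> where "\<epsilon> n = coef n x / of_real (norm (coef n x))" for n
  have \<epsilon>: "norm (\<epsilon> n) = 1" if "n \<in> L" for n using nz[OF that] by (simp add: \<epsilon>_def norm_divide)
  define t where "t n = a / norm (coef n x)" for n
  have "norm (\<Sum>n\<in>L. t n *\<^sub>R (coef n x *\<^sub>K e n)) \<le> 1 * (2 * C * norm x)"
  proof (rule layer_cake_bound[OF fin])
    fix B assume B: "B \<subseteq> L" "\<forall>n\<in>B. \<forall>k\<in>L - B. t k \<le> t n"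
    have "greedy x (L - B)"
    proof (rule greedyI)
      fix n k assume nk: "n \<in> L - B" "k \<notin> L - B"
      show "norm (coef k x) \<le> norm (coef n x)"
      proof (cases "k \<in> B")
        case True
        then have "t n \<le> t k" using B nk by auto
        then show ?thesis using a0 nz[of n] nz[of k] True B nk by (auto simp: t_def field_simps)
      qed (use nk greedyD[OF L] in auto)
    qed (use fin in simp)
    from norm_proj_greedy_diff[OF L this] B(1)
    show "norm (\<Sum>n\<in>B. coef n x *\<^sub>K e n) \<le> 2 * C * norm x"
      by (simp add: double_diff coord_proj_def)
  qed (use a a0 nz in \<open>auto simp: t_def\<close>)
  moreover have "t n *\<^sub>R (coef n x *\<^sub>K e n) = a *\<^sub>R (\<epsilon> n *\<^sub>K e n)" for n
    by (simp add: t_def \<epsilon>_def of_real_divide mult_ac divide_inverse flip: scale_of_real)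
  ultimately have z: "a * norm (\<Sum>n\<in>L. \<epsilon> n *\<^sub>K e n) \<le> 2 * C * norm x"
    using a0 by (simp flip: scaleR_sum_right)
  have "a * norm (ones L) \<le> a * (8 * C * norm (\<Sum>n\<in>L. \<epsilon> n *\<^sub>K e n))"
    using ones_le_signed_sum[OF fin, of \<epsilon>] \<epsilon> a by (intro mult_left_mono) auto
  also have "\<dots> = 8 * C * (a * norm (\<Sum>n\<in>L. \<epsilon> n *\<^sub>K e n))" by simp
  also have "\<dots> \<le> 8 * C * (2 * C * norm x)" using z C by (intro mult_left_mono) auto
  finally show ?thesis by (simp add: power2_eq_square mult_ac)
qed (use C in simp)

text \<open>
  Let \<open>\<alpha>\<close> be the least modulus of a coefficient of \<open>x\<close> on \<open>L - A\<close>; off \<open>L\<close> the coefficients of \<open>x\<close> do not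
  exceed \<open>\<alpha>\<close>. The competitor \<open>y\<close> has the same coefficients as \<open>x\<close> off \<open>A\<close>, so adding to \<open>L - A\<close> the indices
  of \<open>A\<close> at which \<open>y\<close> is at least \<open>\<alpha>\<close> gives a greedy set \<open>G\<close> of \<open>y\<close>. As \<open>G \<union> A = L \<union> A\<close>,

  \<open>x - P\<^sub>L x = (y - P\<^sub>G y) - P\<^bsub>A - G\<^esub> y + P\<^bsub>A - L\<^esub> x\<close>.

  The last two terms have coefficients of modulus at most \<open>\<alpha>\<close> and, by the cardinality hypotheses, their
  supports are not much larger than \<open>G\<close>; so they are bounded by a multiple of \<open>\<alpha> 1\<^sub>G\<close>, and thereby of \<open>y\<close>. The
  second of these hypotheses counts the indices in \<open>A\<close> at which \<open>y\<close> has a nonzero coefficient: with \<open>a\<^sub>n\<close> equal to the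
  coefficients of \<open>x\<close> it is void, which yields the almost greedy inequality, and for \<open>\<lambda>\<close>-greediness it is
  the place where \<open>\<lambda> > 1\<close> enters.
\<close>

lemma greedy_comparison:
  assumes D: "\<And>A B. finite A \<Longrightarrow> finite B \<Longrightarrow> card A \<le> M * card B \<Longrightarrow> norm (ones A) \<le> D * norm (ones B)"
    and M: "M \<ge> 1" and D0: "D \<ge> 0"
    and L: "greedy x L" and A: "finite A"
    and card: "card (A - L) \<le> card (L - A)"
      "card {n\<in>A. a n \<noteq> coef n x} \<le> M * card (L - A)"
  shows "norm (x - proj L x) \<le> (C + 128 * D * C\<^sup>2) * norm (x - (\<Sum>n\<in>A. a n *\<^sub>K e n))"
proof -
  have finL: "finite L" using L greedy_finite by blast
  define y where "y = x - (\<Sum>n\<in>A. a n *\<^sub>K e n)"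
  have ycoef: "coef n y = (if n \<in> A then coef n x - a n else coef n x)" for n
    using A by (simp add: y_def)
  show ?thesis
  proof (cases "L - A = {}")
    case True
    then have "card (A - L) = 0" using card(1) by (metis card.empty le_zero_eq)
    then have "A - L = {}" using A by simp
    then have "L = A" using True by auto
    moreover have "\<forall>n\<in>A. a n = coef n x" using card(2) A True by auto
    ultimately have "x - proj L x = y" by (simp add: y_def coord_proj_def)
    moreover have "1 * norm y \<le> (C + 128 * D * C\<^sup>2) * norm y"
      using C D0 by (intro mult_right_mono) (auto intro: add_increasing2)
    ultimately show ?thesis by (simp add: y_def)
  next
    case False
    define \<alpha> where "\<alpha> = Min ((\<lambda>n. norm (coef n x)) ` (L - A))"
    have \<alpha>le: "\<alpha> \<le> norm (coef n x)" if "n \<in> L - A" for n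
      unfolding \<alpha>_def using that finL by (intro Min_le) auto
    have \<alpha>ge: "norm (coef n x) \<le> \<alpha>" if "n \<notin> L" for n
      unfolding \<alpha>_def using that finL False greedyD[OF L _ that] by (intro Min.boundedI) auto
    have \<alpha>0: "0 \<le> \<alpha>" unfolding \<alpha>_def using finL False by (intro Min.boundedI) auto
    define G where "G = (L - A) \<union> {n \<in> A. \<alpha> \<le> norm (coef n y)}"
    have finG: "finite G" using finL A by (simp add: G_def)
    have cardG: "card (L - A) \<le> card G" by (rule card_mono[OF finG]) (auto simp: G_def)
    have \<alpha>G: "\<alpha> \<le> norm (coef n y)" if "n \<in> G" for n
      using that \<alpha>le by (auto simp: G_def ycoef)
    have \<alpha>nG: "norm (coef n y) \<le> \<alpha>" if "n \<notin> G" for n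
      using that \<alpha>ge[of n] by (auto simp: G_def ycoef split: if_splits)
    have G: "greedy y G"
      by (rule greedyI[OF finG]) (use \<alpha>G \<alpha>nG order_trans in blast)
    have yG: "\<alpha> * norm (ones G) \<le> 16 * C\<^sup>2 * norm y"
      by (rule ones_le_of_greedy[OF G \<alpha>0 \<alpha>G])
    have flat: "norm (\<Sum>n\<in>S. c n *\<^sub>K e n) \<le> 64 * D * C\<^sup>2 * norm y"
      if S: "finite S" "card S \<le> M * card G" and c: "\<And>n. n \<in> S \<Longrightarrow> norm (c n) \<le> \<alpha>" for S c
    proof -
      have "norm (\<Sum>n\<in>S. c n *\<^sub>K e n) \<le> 4 * \<alpha> * (D * norm (ones G))"
      proof (rule lincomb_le_ones[OF S(1) \<alpha>0 c])
        fix B assume "B \<subseteq> S"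
        then show "norm (ones B) \<le> D * norm (ones G)"
          using S finG card_mono[OF S(1)] by (intro D) (auto intro: finite_subset order_trans)
      qed
      also have "\<dots> = 4 * D * (\<alpha> * norm (ones G))" by simp
      also have "\<dots> \<le> 4 * D * (16 * C\<^sup>2 * norm y)" using yG D0 by (intro mult_left_mono) auto
      finally show ?thesis by simp
    qed
    have 1: "norm (proj (A - L) x) \<le> 64 * D * C\<^sup>2 * norm y"
      unfolding coord_proj_def
    proof (rule flat)
      have "card (A - L) \<le> 1 * card G" using card(1) cardG by simp
      also have "\<dots> \<le> M * card G" using M by (intro mult_le_mono1)
      finally show "card (A - L) \<le> M * card G" .
    qed (use A \<alpha>ge in auto)
    have 2: "norm (proj (A - G) y) \<le> 64 * D * C\<^sup>2 * norm y"
    proof -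
      let ?S = "{n \<in> A - G. a n \<noteq> coef n x}"
      have "proj (A - G) y = (\<Sum>n\<in>?S. coef n y *\<^sub>K e n)"
        unfolding coord_proj_def using A by (intro sum.mono_neutral_right) (auto simp: ycoef)
      moreover have "norm (\<Sum>n\<in>?S. coef n y *\<^sub>K e n) \<le> 64 * D * C\<^sup>2 * norm y"
      proof (rule flat)
        have "card ?S \<le> card {n\<in>A. a n \<noteq> coef n x}" using A by (intro card_mono) auto
        also have "\<dots> \<le> M * card G" using card(2) cardG by (meson mult_le_mono2 order_trans)
        finally show "card ?S \<le> M * card G" .
      qed (use A \<alpha>nG in auto)
      ultimately show ?thesis by simp
    qed
    have "x - proj L x = ((y - proj G y) - proj (A - G) y) + proj (A - L) x"
    proof -
      have u: "G \<union> (A - G) = L \<union> (A - L)" by (auto simp: G_def)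
      have "proj G y + proj (A - G) y = proj (L \<union> (A - L)) y"
        using finG A u by (subst u[symmetric], subst proj_Un) auto
      also have "\<dots> = proj (L \<union> (A - L)) x - (\<Sum>n\<in>A. a n *\<^sub>K e n)"
      proof -
        have "A \<inter> (L \<union> (A - L)) = A" by auto
        then show ?thesis
          unfolding y_def proj_diff_vector using A finL by (subst proj_lincomb) auto
      qed
      also have "proj (L \<union> (A - L)) x = proj L x + proj (A - L) x"
        using A finL by (intro proj_Un) auto
      finally show ?thesis by (simp add: y_def algebra_simps)
    qed
    then have "norm (x - proj L x) \<le> norm (y - proj G y) + norm (proj (A - G) y) + norm (proj (A - L) x)"
      by (smt (verit) norm_triangle_ineq norm_triangle_ineq4)
    also have "\<dots> \<le> C * norm y + 64 * D * C\<^sup>2 * norm y + 64 * D * C\<^sup>2 * norm y"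
      using 1 2 qg[OF G] by linarith
    finally show ?thesis by (simp add: y_def algebra_simps)
  qed
qed

text \<open>
  \<open>B\<close> is a greedy set of \<open>w = x + 1\<^bsub>\<delta>B\<^esub>\<close> with remainder \<open>x\<close>. Quasi-greediness bounds \<open>x\<close> by \<open>w\<close>, and \<open>1\<^sub>B\<close> is
  bounded by \<open>w\<close> as well.
\<close>

lemma signed_sum_comparison:
  assumes D: "\<And>A B. finite A \<Longrightarrow> finite B \<Longrightarrow> card A \<le> card B \<Longrightarrow> norm (ones A) \<le> D * norm (ones B)"
    and D0: "D \<ge> 0"
    and x: "coord_sup_norm smul e x \<le> 1" and A: "finite A" and B: "finite B" "B \<inter> supp smul e x = {}"
    and card: "card A \<le> card B" and sign: "is_sign \<epsilon>" "is_sign \<delta>"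
  shows "norm (x + signed_indic_sum smul e \<epsilon> A) \<le> (C + 64 * D * C\<^sup>2) * norm (x + signed_indic_sum smul e \<delta> B)"
proof -
  define w where "w = x + signed_indic_sum smul e \<delta> B"
  obtain F where F: "F > 0" "\<And>n x. norm (coef n x) \<le> F * norm x" by (rule coef_bounded) auto
  have "bdd_above (range (\<lambda>n. norm (coef n x)))"
    by (rule bdd_aboveI2) (rule F(2))
  then have x1: "norm (coef n x) \<le> 1" for n
    using x cSUP_upper[of n UNIV "\<lambda>n. norm (coef n x)"] unfolding coord_sup_norm_def by simp
  have xB: "coef n x = 0" if "n \<in> B" for n using B(2) that by (auto simp: supp_def)
  have wcoef: "coef n w = (if n \<in> B then \<delta> n else coef n x)" for n
    using B(1) xB by (simp add: w_def signed_indic_sum_def)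
  have g: "greedy w B" by (rule greedyI) (use B sign x1 in \<open>auto simp: wcoef is_sign_def\<close>)
  have "proj B w = signed_indic_sum smul e \<delta> B"
    by (simp add: coord_proj_def signed_indic_sum_def wcoef)
  then have 1: "norm x \<le> C * norm w" using qg[OF g] by (simp add: w_def)
  have "1 * norm (ones B) \<le> 16 * C\<^sup>2 * norm w"
    by (rule ones_le_of_greedy[OF g]) (use sign in \<open>auto simp: wcoef is_sign_def\<close>)
  then have B16: "norm (ones B) \<le> 16 * C\<^sup>2 * norm w" by simp
  have "norm (signed_indic_sum smul e \<epsilon> A) \<le> 4 * 1 * (D * norm (ones B))"
    unfolding signed_indic_sum_def
  proof (rule lincomb_le_ones[OF A])
    fix A' assume "A' \<subseteq> A"
    then show "norm (ones A') \<le> D * norm (ones B)"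
      using A B card card_mono[OF A] by (intro D) (auto intro: finite_subset order_trans)
  qed (use sign in \<open>auto simp: is_sign_def\<close>)
  also have "\<dots> \<le> 4 * 1 * (D * (16 * C\<^sup>2 * norm w))"
    using B16 D0 by (intro mult_left_mono) auto
  finally show ?thesis
    using 1 norm_triangle_ineq[of x "signed_indic_sum smul e \<epsilon> A"] by (simp add: w_def algebra_simps)
qed

section \<open>Democracy up to proportional cardinalities\<close>

lemma ones_split:
  assumes K: "\<And>A. finite A \<Longrightarrow> card A \<le> t \<Longrightarrow> norm (ones A) \<le> K"
  shows "finite A \<Longrightarrow> card A \<le> k * t \<Longrightarrow> norm (ones A) \<le> real k * K"
proof (induction k arbitrary: A)
  case 0
  then show ?case by (simp add: indic_sum_def)
next
  case (Suc k)
  obtain B where B: "B \<subseteq> A" "card B = min t (card A)"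
    by (rule obtain_subset_with_card_n[OF min.cobounded2])
  have finB: "finite B" using B Suc.prems finite_subset by blast
  have "card (A - B) \<le> k * t" using B finB Suc.prems by (auto simp: card_Diff_subset)
  then have "norm (ones (A - B)) \<le> real k * K" using Suc by simp
  moreover have "norm (ones B) \<le> K" using K finB B by simp
  moreover have "ones A = ones B + ones (A - B)"
    using B Suc.prems by (simp add: indic_sum_def sum_diff)
  ultimately show ?case using norm_triangle_ineq[of "ones B" "ones (A - B)"] by (simp add: algebra_simps)
qed

text \<open>
  If \<open>R \<ge> l\<close> is an integer and \<open>R\<^sup>2 |A| \<le> |B|\<close>, then there is room for a set \<open>S\<close> disjoint from both and for a
  subset \<open>B'\<close> of \<open>B\<close> such that the hypothesis applies to \<open>A, S\<close> and to \<open>S, B'\<close>; and \<open>1\<^bsub>B'\<^esub>\<close> is controlled by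
  \<open>1\<^sub>B\<close>. A set \<open>A\<close> with \<open>|A| \<le> M |B|\<close> is cut into at most \<open>2 R\<^sup>2 M\<close> pieces to which this applies.
\<close>

lemma proportional_democracy:
  assumes l: "l \<ge> 1" and C1: "C1 \<ge> 1"
    and weak: "\<And>A B. finite A \<Longrightarrow> finite B \<Longrightarrow> A \<inter> B = {} \<Longrightarrow> card B = nat \<lceil>l * real (card A)\<rceil> \<Longrightarrow>
      norm (ones A) \<le> C1 * norm (ones B)"
  shows "\<exists>D\<ge>1. \<forall>A B. finite A \<and> finite B \<and> card A \<le> M * card B \<longrightarrow> norm (ones A) \<le> D * norm (ones B)"
proof -
  obtain F where F: "F > 0" "\<And>n x. norm (coef n x) \<le> F * norm x" by (rule coef_bounded) auto
  obtain E where E: "E > 0" "\<And>n. norm (e n) \<le> E" by (rule norm_basis_bounded) auto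
  obtain R :: nat where R: "l \<le> real R" using real_arch_simple by blast
  then have R1: "R \<ge> 1" using l by linarith
  define L where "L = R * R"
  have L1: "L \<ge> 1" using R1 by (simp add: L_def)
  have ceil: "nat \<lceil>l * real k\<rceil> \<le> R * k" for k :: nat
  proof -
    have "l * real k \<le> real (R * k)" using R by (simp add: mult_right_mono)
    then show ?thesis by linarith
  qed
  have 1: "norm (ones A) \<le> C1 * (C1 * (C * norm (ones B)))"
    if A: "finite A" "finite B" "L * card A \<le> card B" for A B
  proof -
    have "infinite (- (A \<union> B))" using A finite_compl[of "A \<union> B"] by simp
    then obtain S where S: "finite S" "card S = nat \<lceil>l * real (card A)\<rceil>" "S \<subseteq> - (A \<union> B)"
      using infinite_arbitrarily_large by blast
    have "nat \<lceil>l * real (card S)\<rceil> \<le> R * card S" by (rule ceil)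
    also have "\<dots> \<le> R * (R * card A)" using ceil[of "card A"] S(2) by simp
    also have "\<dots> \<le> card B" using A(3) by (simp add: L_def mult.assoc)
    finally obtain B' where B': "B' \<subseteq> B" "card B' = nat \<lceil>l * real (card S)\<rceil>" "finite B'"
      using obtain_subset_with_card_n by metis
    have "norm (ones A) \<le> C1 * norm (ones S)" by (rule weak) (use A S in auto)
    moreover have "norm (ones S) \<le> C1 * norm (ones B')" by (rule weak) (use B' S in auto)
    moreover have "norm (ones B') \<le> C * norm (ones B)" by (rule ones_subset_le) (use A B' in auto)
    ultimately show ?thesis using C1 by (smt (verit) mult_left_mono)
  qed
  define K where "K = C1 * C1 * C + E * F"
  have K: "norm (ones A) \<le> (real (2 * L * M) * K) * norm (ones B)"
    if A: "finite A" "finite B" "card A \<le> M * card B" for A B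
  proof (cases "B = {}")
    case True
    then show ?thesis using A by (simp add: indic_sum_def)
  next
    case False
    then obtain n where n: "n \<in> B" by blast
    have one: "1 \<le> F * norm (ones B)" using F(2)[of n "ones B"] n A by simp
    \<comment> \<open>if \<open>B\<close> has fewer than \<open>L\<close> elements, the pieces are singletons, which \<open>one\<close> compares with \<open>B\<close>\<close>
    define t where "t = max 1 (card B div L)"
    have "norm (ones A') \<le> K * norm (ones B)" if A': "finite A'" "card A' \<le> t" for A'
    proof (cases "card A' \<le> card B div L")
      case True
      then have "L * card A' \<le> card B"
        by (metis mult_le_mono2 order_trans times_div_less_eq_dividend)
      then have "norm (ones A') \<le> C1 * C1 * C * norm (ones B)" using 1[of A' B] A A' by (simp add: mult.assoc)
      also have "\<dots> \<le> K * norm (ones B)" using E F by (intro mult_right_mono) (auto simp: K_def)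
      finally show ?thesis .
    next
      case False
      then have "card A' = 1" using A' by (auto simp: t_def max_def split: if_splits)
      then obtain k where "A' = {k}" by (meson card_1_singletonE)
      then have "norm (ones A') \<le> E * 1" using E by (simp add: indic_sum_def)
      also have "\<dots> \<le> E * (F * norm (ones B))" using one E by (intro mult_left_mono) auto
      also have "\<dots> \<le> K * norm (ones B)"
        unfolding mult.assoc[symmetric] using C C1 by (intro mult_right_mono) (auto simp: K_def)
      finally show ?thesis .
    qed
    moreover have "card A \<le> (2 * L * M) * t"
    proof -
      have "card B \<le> L * (card B div L) + L"
        using L1 by (metis add_left_mono div_mult_mod_eq less_imp_le_nat mod_less_divisor mult.commute
            less_le_trans zero_less_one)
      also have "\<dots> \<le> L * t + L * t" by (intro add_mono mult_le_mono2) (auto simp: t_def)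
      finally have "M * card B \<le> M * (2 * L * t)" by (intro mult_le_mono2) simp
      also have "\<dots> = (2 * L * M) * t" by simp
      finally show ?thesis using A(3) by linarith
    qed
    ultimately show ?thesis using ones_split[of t "K * norm (ones B)" A "2 * L * M"] A by (simp add: mult_ac)
  qed
  show ?thesis
  proof (intro exI[of _ "max 1 (real (2 * L * M) * K)"] conjI allI impI)
    fix A B :: "nat set" assume "finite A \<and> finite B \<and> card A \<le> M * card B"
    then have "norm (ones A) \<le> real (2 * L * M) * K * norm (ones B)" using K by blast
    also have "\<dots> \<le> max 1 (real (2 * L * M) * K) * norm (ones B)"
      by (intro mult_right_mono) auto
    finally show "norm (ones A) \<le> max 1 (real (2 * L * M) * K) * norm (ones B)" .
  qed simp
qed

end

section \<open>The equivalences\<close>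

text \<open>
  The number \<open>M\<close> is arbitrary, rather than \<open>M = 1\<close>, because \<open>\<lambda>\<close>-greediness for \<open>\<lambda>\<close> close to \<open>1\<close> compares sets
  \<open>A\<close> with much smaller ones.
\<close>

definition fully_democratic :: bool where
  "fully_democratic \<longleftrightarrow> (\<forall>M. \<exists>D\<ge>1. \<forall>A B. finite A \<and> finite B \<and> card A \<le> M * card B \<longrightarrow>
    norm (ones A) \<le> D * norm (ones B))"

lemma fully_democraticI:
  assumes "quasi_greedy smul e" "l \<ge> 1" "C1 \<ge> 1"
    and "\<And>A B. finite A \<Longrightarrow> finite B \<Longrightarrow> A \<inter> B = {} \<Longrightarrow> card B = nat \<lceil>l * real (card A)\<rceil> \<Longrightarrow>
      norm (ones A) \<le> C1 * norm (ones B)"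
  shows "fully_democratic"
proof -
  obtain C where "C \<ge> 1" "\<And>x L. greedy x L \<Longrightarrow> norm (x - proj L x) \<le> C * norm x"
    using assms(1) unfolding quasi_greedy_iff by blast
  from proportional_democracy[OF this assms(2-4)] show ?thesis
    unfolding fully_democratic_def by blast
qed

abbreviation strongly_greedy :: bool where
  "strongly_greedy \<equiv> quasi_greedy smul e \<and> fully_democratic"

lemma strongly_greedy_of_lam_democratic:
  assumes "quasi_greedy smul e" "l \<ge> 1" "lam_democratic l e"
  shows strongly_greedy
proof -
  obtain C1 where C1: "C1 \<ge> 1" "\<And>A B. finite A \<Longrightarrow> finite B \<Longrightarrow> l * real (card A) \<le> real (card B) \<Longrightarrow>
      norm (ones A) \<le> C1 * norm (ones B)"
    using assms(3) unfolding lam_democratic_def by blast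
  have fully_democratic
    by (rule fully_democraticI[OF assms(1,2) C1(1)]) (rule C1(2), auto simp: real_nat_ceiling_ge)
  with assms(1) show ?thesis by blast
qed

lemma strongly_greedy_of_democratic:
  assumes "quasi_greedy smul e" "democratic e"
  shows strongly_greedy
proof -
  obtain C1 where C1: "C1 \<ge> 1" "\<And>A B. finite A \<Longrightarrow> finite B \<Longrightarrow> card A = card B \<Longrightarrow>
      norm (ones A) \<le> C1 * norm (ones B)"
    using assms(2) unfolding democratic_def by blast
  have fully_democratic
    by (rule fully_democraticI[OF assms(1) order_refl C1(1)]) (rule C1(2), auto)
  with assms(1) show ?thesis by blast
qed

lemma signed_indic_sum_one: "signed_indic_sum smul e (\<lambda>_. 1) A = ones A"
  by (simp add: signed_indic_sum_def indic_sum_def)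

lemma coord_sup_norm_zero: "coord_sup_norm smul e 0 = 0"
  by (simp add: coord_sup_norm_def)

lemma strongly_greedy_of_lam_SLC:
  assumes "quasi_greedy smul e" "l \<ge> 1" "lam_SLC l smul e"
  shows strongly_greedy
proof -
  obtain C1 where C1: "C1 \<ge> 1" "\<And>x A B \<epsilon> \<delta>. coord_sup_norm smul e x \<le> 1 \<and> finite A \<and> finite B \<and>
      l * real (card A) \<le> real (card B) \<and>
      A \<inter> B = {} \<and> A \<inter> supp smul e x = {} \<and> B \<inter> supp smul e x = {} \<and>
      is_sign \<epsilon> \<and> is_sign \<delta> \<Longrightarrow>
      norm (x + signed_indic_sum smul e \<epsilon> A) \<le> C1 * norm (x + signed_indic_sum smul e \<delta> B)"
    using assms(3) unfolding lam_SLC_def by blast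
  have fully_democratic
  proof (rule fully_democraticI[OF assms(1,2) C1(1)])
    fix A B :: "nat set"
    assume "finite A" "finite B" "A \<inter> B = {}" "card B = nat \<lceil>l * real (card A)\<rceil>"
    then show "norm (ones A) \<le> C1 * norm (ones B)"
      using C1(2)[of 0 A B "\<lambda>_. 1" "\<lambda>_. 1"]
      by (auto simp: real_nat_ceiling_ge signed_indic_sum_one coord_sup_norm_zero supp_def is_sign_def)
  qed
  with assms(1) show ?thesis by blast
qed

lemma strongly_greedy_of_SLC:
  assumes "quasi_greedy smul e" "SLC smul e"
  shows strongly_greedy
proof -
  obtain C1 where C1: "C1 \<ge> 1" "\<And>x A B \<epsilon> \<delta>. coord_sup_norm smul e x \<le> 1 \<and> finite A \<and> finite B \<and>
      card A = card B \<and>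
      A \<inter> B = {} \<and> A \<inter> supp smul e x = {} \<and> B \<inter> supp smul e x = {} \<and>
      is_sign \<epsilon> \<and> is_sign \<delta> \<Longrightarrow>
      norm (x + signed_indic_sum smul e \<epsilon> A) \<le> C1 * norm (x + signed_indic_sum smul e \<delta> B)"
    using assms(2) unfolding SLC_def by blast
  have fully_democratic
  proof (rule fully_democraticI[OF assms(1) order_refl C1(1)])
    fix A B :: "nat set"
    assume "finite A" "finite B" "A \<inter> B = {}" "card B = nat \<lceil>1 * real (card A)\<rceil>"
    then show "norm (ones A) \<le> C1 * norm (ones B)"
      using C1(2)[of 0 A B "\<lambda>_. 1" "\<lambda>_. 1"]
      by (auto simp: real_nat_ceiling_ge signed_indic_sum_one coord_sup_norm_zero supp_def is_sign_def)
  qed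
  with assms(1) show ?thesis by blast
qed

text \<open>
  Covers both \<open>\<lambda>\<close>-greedy and \<open>\<lambda>\<close>-almost greedy bases: \<open>\<rho>\<close> stands for either of the best approximation
  errors. Democracy is read off from \<open>x = 1\<^sub>A + 1\<^sub>B\<close>, where the greedy set \<open>B\<close> leaves \<open>1\<^sub>A\<close> and the
  competitor \<open>P\<^sub>A x\<close> leaves \<open>1\<^sub>B\<close>.
\<close>

lemma strongly_greedy_of_error_bound:
  assumes l: "l \<ge> 1" and C: "C \<ge> 1"
    and err: "\<And>x m. greedy_error smul e (nat \<lceil>l * real m\<rceil>) x \<le> C * \<rho> m x"
    and norm: "\<And>x m. \<rho> m x \<le> norm x"
    and proj: "\<And>x A. finite A \<Longrightarrow> \<rho> (card A) x \<le> norm (x - proj A x)"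
  shows strongly_greedy
proof
  have le: "C * a \<le> C * b" if "a \<le> b" for a b using that C by (intro mult_left_mono) auto
  show qg: "quasi_greedy smul e"
    using quasi_greedy_of_sparse_sizes[OF l C] err norm le order_trans by meson
  show fully_democratic
  proof (rule fully_democraticI[OF qg l C])
    fix A B :: "nat set"
    assume A: "finite A" "finite B" "A \<inter> B = {}" "card B = nat \<lceil>l * real (card A)\<rceil>"
    define x where "x = ones (A \<union> B)"
    have "ones (A \<union> B) = ones A + ones B" unfolding indic_sum_def using A by (intro sum.union_disjoint)
    then have xB: "x - proj B x = ones A" and xA: "x - proj A x = ones B"
      using A proj_ones[of "A \<union> B" A] proj_ones[of "A \<union> B" B] by (auto simp: x_def)
    have "greedy x B" by (rule greedyI) (use A in \<open>auto simp: x_def\<close>)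
    then have "norm (x - proj B x) \<le> C * \<rho> (card A) x"
      using err[of "card A" x] A(4) unfolding greedy_error_le_iff by blast
    also have "\<dots> \<le> C * norm (x - proj A x)" by (rule le[OF proj[OF A(1)]])
    finally show "norm (ones A) \<le> C * norm (ones B)" by (simp add: xA xB)
  qed
qed

lemma strongly_greedy_of_lam_almost_greedy:
  assumes "l \<ge> 1" "lam_almost_greedy l smul e"
  shows strongly_greedy
proof -
  obtain C where "C \<ge> 1"
    "\<And>x m. greedy_error smul e (nat \<lceil>l * real m\<rceil>) x \<le> C * best_proj_error smul e m x"
    using assms(2) unfolding lam_almost_greedy_def by blast
  from strongly_greedy_of_error_bound[OF assms(1) this best_proj_error_le_norm best_proj_error_le[OF _ refl]]
  show ?thesis .
qed

lemma strongly_greedy_of_lam_greedy: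
  assumes "l \<ge> 1" "lam_greedy l smul e"
  shows strongly_greedy
proof -
  have proj: "best_error smul e (card A) x \<le> norm (x - proj A x)" if "finite A" for A x
    using best_error_le[OF that order_refl, of x "\<lambda>n. coef n x"] by (simp add: coord_proj_def)
  obtain C where "C \<ge> 1"
    "\<And>x m. greedy_error smul e (nat \<lceil>l * real m\<rceil>) x \<le> C * best_error smul e m x"
    using assms(2) unfolding lam_greedy_def by blast
  from strongly_greedy_of_error_bound[OF assms(1) this best_error_le_norm proj] show ?thesis .
qed

lemma almost_greedy_eq: "almost_greedy smul e \<longleftrightarrow> lam_almost_greedy 1 smul e"
  by (simp add: almost_greedy_def lam_almost_greedy_def)

lemma le_of_lam_mult_le:
  assumes "l \<ge> 1" "l * real a \<le> real b" shows "a \<le> b"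
proof -
  have "1 * real a \<le> l * real a" using assms(1) by (intro mult_right_mono) auto
  then show ?thesis using assms(2) by linarith
qed

context
  assumes sg: strongly_greedy
begin

lemma comparable_ones:
  obtains D where "D \<ge> 1" "\<And>A B. finite A \<Longrightarrow> finite B \<Longrightarrow> card A \<le> M * card B \<Longrightarrow>
    norm (ones A) \<le> D * norm (ones B)"
  using sg unfolding fully_democratic_def by meson

lemma quasi_greedy_const:
  obtains C where "C \<ge> 1" "\<And>x L. greedy x L \<Longrightarrow> norm (x - proj L x) \<le> C * norm x"
  using sg unfolding quasi_greedy_iff by meson

lemma strongly_greedy_democratic: "democratic e"
proof -
  obtain D where "D \<ge> 1" "\<And>A B. finite A \<Longrightarrow> finite B \<Longrightarrow> card A \<le> 1 * card B \<Longrightarrow>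
    norm (ones A) \<le> D * norm (ones B)" by (rule comparable_ones[of 1]) auto
  then show ?thesis unfolding democratic_def by (intro exI[of _ D]) simp
qed

lemma strongly_greedy_lam_democratic:
  assumes "l \<ge> 1" shows "lam_democratic l e"
proof -
  obtain D where "D \<ge> 1" "\<And>A B. finite A \<Longrightarrow> finite B \<Longrightarrow> card A \<le> 1 * card B \<Longrightarrow>
    norm (ones A) \<le> D * norm (ones B)" by (rule comparable_ones[of 1]) auto
  then show ?thesis unfolding lam_democratic_def
    using le_of_lam_mult_le[OF assms] by (intro exI[of _ D]) simp
qed

lemma strongly_greedy_signed_sums:
  obtains K where "K \<ge> 1" "\<And>x A B \<epsilon> \<delta>. coord_sup_norm smul e x \<le> 1 \<Longrightarrow> finite A \<Longrightarrow> finite B \<Longrightarrow>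
    B \<inter> supp smul e x = {} \<Longrightarrow> card A \<le> card B \<Longrightarrow> is_sign \<epsilon> \<Longrightarrow> is_sign \<delta> \<Longrightarrow>
    norm (x + signed_indic_sum smul e \<epsilon> A) \<le> K * norm (x + signed_indic_sum smul e \<delta> B)"
proof -
  obtain C where C: "C \<ge> 1" "\<And>x L. greedy x L \<Longrightarrow> norm (x - proj L x) \<le> C * norm x"
    by (rule quasi_greedy_const) auto
  obtain D where D: "D \<ge> 1" "\<And>A B. finite A \<Longrightarrow> finite B \<Longrightarrow> card A \<le> 1 * card B \<Longrightarrow>
    norm (ones A) \<le> D * norm (ones B)" by (rule comparable_ones[of 1]) auto
  show ?thesis
  proof (rule that[of "C + 64 * D * C\<^sup>2"])
    show "C + 64 * D * C\<^sup>2 \<ge> 1" using C D by (intro add_increasing2) auto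
  qed (rule signed_sum_comparison[OF C], use D in auto)
qed

lemma strongly_greedy_SLC: "SLC smul e"
  by (rule strongly_greedy_signed_sums) (force simp: SLC_def)

lemma strongly_greedy_lam_SLC:
  assumes "l \<ge> 1" shows "lam_SLC l smul e"
  by (rule strongly_greedy_signed_sums)
    (unfold lam_SLC_def, blast intro: le_of_lam_mult_le[OF assms])

lemma strongly_greedy_lam_almost_greedy:
  assumes l: "l \<ge> 1" shows "lam_almost_greedy l smul e"
proof -
  obtain C where C: "C \<ge> 1" "\<And>x L. greedy x L \<Longrightarrow> norm (x - proj L x) \<le> C * norm x"
    by (rule quasi_greedy_const) auto
  obtain D where D: "D \<ge> 1" "\<And>A B. finite A \<Longrightarrow> finite B \<Longrightarrow> card A \<le> 1 * card B \<Longrightarrow>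
    norm (ones A) \<le> D * norm (ones B)" by (rule comparable_ones[of 1]) auto
  define K where "K = C + 128 * D * C\<^sup>2"
  have K1: "K \<ge> 1" unfolding K_def using C D by (intro add_increasing2) auto
  have "norm (x - proj L x) \<le> K * norm (x - proj A x)"
    if L: "greedy x L" "card L = nat \<lceil>l * real (card A)\<rceil>" and A: "finite A" for x L A
  proof -
    have "l * real (card A) \<le> real (card L)" unfolding L(2) by linarith
    then have "card A \<le> card L" by (rule le_of_lam_mult_le[OF l])
    then have "card (A - L) \<le> card (L - A)"
      using A greedy_finite[OF L(1)] by (simp add: card_le_sym_Diff)
    then show ?thesis
      using greedy_comparison[where M = 1 and a = "\<lambda>n. coef n x", OF C D(2) _ _ L(1) A] D(1)
      by (simp add: K_def coord_proj_def)
  qed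
  then show ?thesis
    unfolding lam_almost_greedy_def greedy_error_le_iff
    using K1 by (intro exI[of _ K]) (auto intro!: le_mult_best_proj_error)
qed

text \<open>
  From \<open>|L| \<ge> l |A|\<close> with \<open>l > 1\<close> one gets \<open>|L - A| \<ge> (l - 1) |A|\<close>, so that \<open>A\<close> is at most \<open>M\<close> times as large as
  \<open>L - A\<close> for any \<open>M \<ge> 1 / (l - 1)\<close>.
\<close>

lemma strongly_greedy_lam_greedy:
  assumes l: "l > 1" shows "lam_greedy l smul e"
proof -
  obtain M :: nat where M: "1 / (l - 1) \<le> real M" using real_arch_simple by blast
  obtain C where C: "C \<ge> 1" "\<And>x L. greedy x L \<Longrightarrow> norm (x - proj L x) \<le> C * norm x"
    by (rule quasi_greedy_const) auto
  have "0 < 1 / (l - 1)" using l by simp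
  then have M1: "M \<ge> 1" using M by linarith
  obtain D where D: "D \<ge> 1" "\<And>A B. finite A \<Longrightarrow> finite B \<Longrightarrow> card A \<le> M * card B \<Longrightarrow>
    norm (ones A) \<le> D * norm (ones B)" by (rule comparable_ones[of M]) auto
  define K where "K = C + 128 * D * C\<^sup>2"
  have K1: "K \<ge> 1" unfolding K_def using C D by (intro add_increasing2) auto
  have "norm (x - proj L x) \<le> K * norm (x - (\<Sum>n\<in>A. a n *\<^sub>K e n))"
    if L: "greedy x L" "card L = nat \<lceil>l * real m\<rceil>" and A: "finite A" "card A \<le> m" for x L A a m
  proof -
    have fin: "finite L" using L greedy_finite by blast
    have "l * real (card A) \<le> l * real m" using A l by (intro mult_left_mono) auto
    also have "\<dots> \<le> real (card L)" unfolding L(2) by linarith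
    finally have lA: "l * real (card A) \<le> real (card L)" .
    then have "card A \<le> card L" using l by (intro le_of_lam_mult_le) auto
    then have 1: "card (A - L) \<le> card (L - A)" using A fin by (simp add: card_le_sym_Diff)
    have "real (card A) \<le> real M * real (card (L - A))"
    proof -
      have "real (card L) - real (card A) \<le> real (card (L - A))"
        using diff_card_le_card_Diff[OF A(1), of L] by linarith
      then have "(l - 1) * real (card A) \<le> real (card (L - A))" using lA by (simp add: algebra_simps)
      then have "real (card A) \<le> 1 / (l - 1) * real (card (L - A))" using l by (simp add: field_simps)
      also have "\<dots> \<le> real M * real (card (L - A))" using M by (intro mult_right_mono) auto
      finally show ?thesis .
    qed
    then have "card A \<le> M * card (L - A)" by (metis of_nat_le_iff of_nat_mult)
    moreover have "card {n\<in>A. a n \<noteq> coef n x} \<le> card A" using A by (intro card_mono) auto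
    ultimately show ?thesis
      using greedy_comparison[OF C D(2) M1 _ L(1) A(1) 1, where a = a] D(1) by (simp add: K_def)
  qed
  then show ?thesis
    unfolding lam_greedy_def greedy_error_le_iff
    using K1 by (intro exI[of _ K]) (auto intro!: le_mult_best_error)
qed

end

end

theorem theorem3p4:
  fixes smul :: "'k::real_normed_field \<Rightarrow> 'a::banach \<Rightarrow> 'a" and e :: "nat \<Rightarrow> 'a"
  assumes "infdim_banach_space smul"
    and "is_basis smul e"
  shows "all_equivalent
    [almost_greedy smul e,
     quasi_greedy smul e \<and> democratic e,
     \<forall>l>1. lam_greedy l smul e,
     \<exists>l>1. lam_greedy l smul e,
     quasi_greedy smul e \<and> SLC smul e,
     quasi_greedy smul e \<and> (\<forall>l\<ge>1. lam_democratic l e),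
     quasi_greedy smul e \<and> (\<exists>l\<ge>1. lam_democratic l e),
     quasi_greedy smul e \<and> (\<forall>l\<ge>1. lam_SLC l smul e),
     quasi_greedy smul e \<and> (\<exists>l\<ge>1. lam_SLC l smul e),
     \<forall>l\<ge>1. lam_almost_greedy l smul e,
     \<exists>l\<ge>1. lam_almost_greedy l smul e]"
proof -
  interpret basis_setting smul e
    using assms by (simp add: basis_setting_def basis_setting_axioms_def)
  \<comment> \<open>an opaque name, so that the equivalences below are rewriting rules for whole list entries\<close>
  define H where "H \<longleftrightarrow> strongly_greedy"
  have gt1: "\<exists>l::real. l > 1" by (rule exI[of _ 2]) simp
  have ge1: "\<exists>l::real. l \<ge> 1" by (rule exI[of _ 1]) simp
  have "almost_greedy smul e \<longleftrightarrow> H"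
    unfolding almost_greedy_eq H_def
    using strongly_greedy_of_lam_almost_greedy[OF order_refl] strongly_greedy_lam_almost_greedy by blast
  moreover have "quasi_greedy smul e \<and> democratic e \<longleftrightarrow> H"
    unfolding H_def using strongly_greedy_of_democratic strongly_greedy_democratic by blast
  moreover have "(\<forall>l>1. lam_greedy l smul e) \<longleftrightarrow> H"
    and "(\<exists>l>1. lam_greedy l smul e) \<longleftrightarrow> H"
    unfolding H_def using strongly_greedy_of_lam_greedy[OF less_imp_le] strongly_greedy_lam_greedy gt1 by blast+
  moreover have "quasi_greedy smul e \<and> SLC smul e \<longleftrightarrow> H"
    unfolding H_def using strongly_greedy_of_SLC strongly_greedy_SLC by blast
  moreover have "quasi_greedy smul e \<and> (\<forall>l\<ge>1. lam_democratic l e) \<longleftrightarrow> H"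
    and "quasi_greedy smul e \<and> (\<exists>l\<ge>1. lam_democratic l e) \<longleftrightarrow> H"
    unfolding H_def using strongly_greedy_of_lam_democratic strongly_greedy_lam_democratic ge1 by blast+
  moreover have "quasi_greedy smul e \<and> (\<forall>l\<ge>1. lam_SLC l smul e) \<longleftrightarrow> H"
    and "quasi_greedy smul e \<and> (\<exists>l\<ge>1. lam_SLC l smul e) \<longleftrightarrow> H"
    unfolding H_def using strongly_greedy_of_lam_SLC strongly_greedy_lam_SLC ge1 by blast+
  moreover have "(\<forall>l\<ge>1. lam_almost_greedy l smul e) \<longleftrightarrow> H"
    and "(\<exists>l\<ge>1. lam_almost_greedy l smul e) \<longleftrightarrow> H"
    unfolding H_def using strongly_greedy_of_lam_almost_greedy strongly_greedy_lam_almost_greedy ge1 by blast+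
  ultimately show ?thesis
    unfolding all_equivalent_def by simp
qed

end
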